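(* (a) Let $p$ be a prime and let $(B,+,\circ)$ be a finite skew brace. Suppose that one of the following conditions holds: (1) $B$ is a bi-skew brace; (2) $B$ is right nilpotent; (3) $B$ is $\lambda$-homomorphic. If $S$ is any left ideal of $B$ whose order is a power of $p$, then $B$ has a Sylow $p$-sub-skew brace containing $S$. (b) Let $\pi$ be a set of primes and let $(B,+,\circ)$ be a finite skew brace such that the groups $(B,+)$ and $(B,\circ)$ are soluble. Suppose that one of the conditions (1), (2), (3) of part (a) holds. If $S$ is any left ideal of $B$ whose order is a $\pi$-number, then $B$ has a Hall $\pi$-sub-skew brace containing $S$.
   Context: A skew (left) brace is a triple $(B,+,\circ)$ where $(B,+)$ and $(B,\circ)$ are (not necessarily abelian) groups with $a\circ(b+c)=a\circ b-a+a\circ c$ for all $a,b,c\in B$. The map $\lambda:(B,\circ)\to\operatorname{Aut}(B,+)$, $a\mapsto\lambda_a$, with $\lambda_a(b)=-a+a\circ b$, is a group homomorphism. Put $a\ast b=\lambda_a(b)-b=-a+a\circ b-b$, and for subsets $X,Y$ of $B$ let $X\ast Y$ be the subgroup of $(B,+)$ generated by all $x\ast y$ with $x\in X$, $y\in Y$. $B$ is a bi-skew brace if both $(B,+,\circ)$ and $(B,\circ,+)$ are skew braces. $B$ is right nilpotent if $(\ldots((B\ast B)\ast B)\ldots)\ast B=\{0\}$ for some finite number of iterations, i.e. if $R_n=\{0\}$ for some $n$, where $R_1=B$ and $R_{k+1}=R_k\ast B$. $B$ is $\lambda$-homomorphic if $a\mapsto\lambda_a$ is also a homomorphism from the group $(B,+)$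 to $\operatorname{Aut}(B,+)$. A sub-skew brace of $B$ is a subset that is a subgroup of both $(B,+)$ and $(B,\circ)$. A left ideal of $B$ is a subgroup $L$ of $(B,+)$ with $\lambda_a(L)\subseteq L$ for all $a\in B$. A $\pi$-number is a positive integer all of whose prime divisors lie in $\pi$. For a finite skew brace $B$, a Sylow $p$-sub-skew brace (resp. Hall $\pi$-sub-skew brace) is a sub-skew brace whose order is the largest power of $p$ (resp. the largest $\pi$-number) dividing $|B|$. *)

theory Defs
  imports
    "HOL-Algebra.Solvable_Groups"
    "HOL-Algebra.Bij"
    "HOL-Computational_Algebra.Primes"
begin

text \<open>
  A skew brace $(B,+,\circ)$ is represented by two group structures \<open>A\<close> $= (B,+)$ and
  \<open>M\<close> $= (B,\circ)$ on the same carrier. In particular \<open>\<otimes>\<^bsub>A\<^esub>\<close>, \<open>\<one>\<^bsub>A\<^esub>\<close> and \<open>inv\<^bsub>A\<^esub>\<close> are the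
  (not necessarily commutative) addition, the zero and the negation of $B$.
\<close>

locale skew_brace = A: group A + M: group M
  for A :: "('a, 'b) monoid_scheme" and M :: "('a, 'c) monoid_scheme" +
  assumes carrier_eq: "carrier M = carrier A"
    and brace_distrib:
      "\<lbrakk>a \<in> carrier A; b \<in> carrier A; c \<in> carrier A\<rbrakk> \<Longrightarrow>
        a \<otimes>\<^bsub>M\<^esub> (b \<otimes>\<^bsub>A\<^esub> c) = (a \<otimes>\<^bsub>M\<^esub> b) \<otimes>\<^bsub>A\<^esub> inv\<^bsub>A\<^esub> a \<otimes>\<^bsub>A\<^esub> (a \<otimes>\<^bsub>M\<^esub> c)"

text \<open>The restriction to the carrier is needed because \<^const>\<open>AutoGroup\<close> consists of
  extensional functions.\<close>

definition lambda_map ::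
  "('a, 'b) monoid_scheme \<Rightarrow> ('a, 'c) monoid_scheme \<Rightarrow> 'a \<Rightarrow> 'a \<Rightarrow> 'a"
  where "lambda_map A M a = (\<lambda>b \<in> carrier A. inv\<^bsub>A\<^esub> a \<otimes>\<^bsub>A\<^esub> (a \<otimes>\<^bsub>M\<^esub> b))"

definition brace_star ::
  "('a, 'b) monoid_scheme \<Rightarrow> ('a, 'c) monoid_scheme \<Rightarrow> 'a \<Rightarrow> 'a \<Rightarrow> 'a"
  where "brace_star A M a b = lambda_map A M a b \<otimes>\<^bsub>A\<^esub> inv\<^bsub>A\<^esub> b"

definition set_star ::
  "('a, 'b) monoid_scheme \<Rightarrow> ('a, 'c) monoid_scheme \<Rightarrow> 'a set \<Rightarrow> 'a set \<Rightarrow> 'a set"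
  where "set_star A M X Y = generate A {brace_star A M x y | x y. x \<in> X \<and> y \<in> Y}"

text \<open>Indexing starts at 0: \<open>right_series A M k\<close> is usually written $R_{k+1}$, with $R_1 = B$.\<close>

primrec right_series ::
  "('a, 'b) monoid_scheme \<Rightarrow> ('a, 'c) monoid_scheme \<Rightarrow> nat \<Rightarrow> 'a set"
  where
    "right_series A M 0 = carrier A"
  | "right_series A M (Suc k) = set_star A M (right_series A M k) (carrier A)"

definition right_nilpotent ::
  "('a, 'b) monoid_scheme \<Rightarrow> ('a, 'c) monoid_scheme \<Rightarrow> bool"
  where "right_nilpotent A M \<longleftrightarrow> (\<exists>n. right_series A M n = {\<one>\<^bsub>A\<^esub>})"

definition bi_skew_brace ::
  "('a, 'b) monoid_scheme \<Rightarrow> ('a, 'c) monoid_scheme \<Rightarrow> bool"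
  where "bi_skew_brace A M \<longleftrightarrow> skew_brace A M \<and> skew_brace M A"

definition lambda_homomorphic ::
  "('a, 'b) monoid_scheme \<Rightarrow> ('a, 'c) monoid_scheme \<Rightarrow> bool"
  where "lambda_homomorphic A M \<longleftrightarrow> lambda_map A M \<in> hom A (AutoGroup A)"

definition sub_skew_brace ::
  "'a set \<Rightarrow> ('a, 'b) monoid_scheme \<Rightarrow> ('a, 'c) monoid_scheme \<Rightarrow> bool"
  where "sub_skew_brace H A M \<longleftrightarrow> subgroup H A \<and> subgroup H M"

definition left_ideal ::
  "'a set \<Rightarrow> ('a, 'b) monoid_scheme \<Rightarrow> ('a, 'c) monoid_scheme \<Rightarrow> bool"
  where "left_ideal L A M \<longleftrightarrow>
    subgroup L A \<and> (\<forall>a \<in> carrier A. lambda_map A M a ` L \<subseteq> L)"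

definition pi_number :: "nat set \<Rightarrow> nat \<Rightarrow> bool"
  where "pi_number \<pi> n \<longleftrightarrow> n > 0 \<and> (\<forall>q. prime q \<and> q dvd n \<longrightarrow> q \<in> \<pi>)"

definition sylow_sub_skew_brace ::
  "nat \<Rightarrow> 'a set \<Rightarrow> ('a, 'b) monoid_scheme \<Rightarrow> ('a, 'c) monoid_scheme \<Rightarrow> bool"
  where "sylow_sub_skew_brace p H A M \<longleftrightarrow>
    sub_skew_brace H A M \<and> card H = Max {m. m dvd order A \<and> (\<exists>k. m = p ^ k)}"

definition hall_sub_skew_brace ::
  "nat set \<Rightarrow> 'a set \<Rightarrow> ('a, 'b) monoid_scheme \<Rightarrow> ('a, 'c) monoid_scheme \<Rightarrow> bool"
  where "hall_sub_skew_brace \<pi> H A M \<longleftrightarrow>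
    sub_skew_brace H A M \<and> card H = Max {m. m dvd order A \<and> pi_number \<pi> m}"

context skew_brace
begin

lemma one_eq: "\<one>\<^bsub>M\<^esub> = \<one>\<^bsub>A\<^esub>"
proof -
  have 1: "\<one>\<^bsub>M\<^esub> \<in> carrier A" using M.one_closed carrier_eq by simp
  have "\<one>\<^bsub>M\<^esub> \<otimes>\<^bsub>M\<^esub> (\<one>\<^bsub>A\<^esub> \<otimes>\<^bsub>A\<^esub> \<one>\<^bsub>A\<^esub>) =
      (\<one>\<^bsub>M\<^esub> \<otimes>\<^bsub>M\<^esub> \<one>\<^bsub>A\<^esub>) \<otimes>\<^bsub>A\<^esub> inv\<^bsub>A\<^esub> \<one>\<^bsub>M\<^esub> \<otimes>\<^bsub>A\<^esub> (\<one>\<^bsub>M\<^esub> \<otimes>\<^bsub>M\<^esub> \<one>\<^bsub>A\<^esub>)"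
    using 1 by (intro brace_distrib) auto
  then have "\<one>\<^bsub>A\<^esub> = inv\<^bsub>A\<^esub> \<one>\<^bsub>M\<^esub>"
    using 1 carrier_eq by simp
  then show ?thesis using 1 by (metis A.inv_inv A.inv_one)
qed

lemma M_closed: "\<lbrakk>a \<in> carrier A; b \<in> carrier A\<rbrakk> \<Longrightarrow> a \<otimes>\<^bsub>M\<^esub> b \<in> carrier A"
  using M.m_closed carrier_eq by simp

lemma lambda_map_add:
  assumes "a \<in> carrier A" "b \<in> carrier A" "c \<in> carrier A"
  shows "lambda_map A M a (b \<otimes>\<^bsub>A\<^esub> c) = lambda_map A M a b \<otimes>\<^bsub>A\<^esub> lambda_map A M a c"
  using assms by (simp add: lambda_map_def brace_distrib A.m_assoc M_closed)

lemma M_eq: "\<lbrakk>a \<in> carrier A; b \<in> carrier A\<rbrakk> \<Longrightarrow> a \<otimes>\<^bsub>M\<^esub> b = a \<otimes>\<^bsub>A\<^esub> lambda_map A M a b"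
  by (simp add: lambda_map_def M_closed A.m_assoc[symmetric])

lemma lambda_map_closed: "\<lbrakk>a \<in> carrier A; b \<in> carrier A\<rbrakk> \<Longrightarrow> lambda_map A M a b \<in> carrier A"
  by (simp add: lambda_map_def M_closed)

lemma lambda_map_mult:
  assumes "a \<in> carrier A" "b \<in> carrier A" "c \<in> carrier A"
  shows "lambda_map A M (a \<otimes>\<^bsub>M\<^esub> b) c = lambda_map A M a (lambda_map A M b c)"
proof -
  have "a \<otimes>\<^bsub>M\<^esub> (b \<otimes>\<^bsub>M\<^esub> c) = a \<otimes>\<^bsub>A\<^esub> lambda_map A M a (b \<otimes>\<^bsub>A\<^esub> lambda_map A M b c)"
    using assms by (simp add: M_eq[symmetric] M_closed lambda_map_closed)
  also have "\<dots> = (a \<otimes>\<^bsub>M\<^esub> b) \<otimes>\<^bsub>A\<^esub> lambda_map A M a (lambda_map A M b c)"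
    using assms by (simp add: lambda_map_add lambda_map_closed M_eq A.m_assoc)
  finally have "(a \<otimes>\<^bsub>M\<^esub> b) \<otimes>\<^bsub>M\<^esub> c = (a \<otimes>\<^bsub>M\<^esub> b) \<otimes>\<^bsub>A\<^esub> lambda_map A M a (lambda_map A M b c)"
    using assms M.m_assoc carrier_eq by simp
  moreover have "(a \<otimes>\<^bsub>M\<^esub> b) \<otimes>\<^bsub>M\<^esub> c = (a \<otimes>\<^bsub>M\<^esub> b) \<otimes>\<^bsub>A\<^esub> lambda_map A M (a \<otimes>\<^bsub>M\<^esub> b) c"
    using assms by (intro M_eq M_closed)
  ultimately show ?thesis
    using assms by (metis A.Units_eq A.Units_l_cancel M_closed lambda_map_closed)
qed

lemma lambda_map_one: "b \<in> carrier A \<Longrightarrow> lambda_map A M \<one>\<^bsub>M\<^esub> b = b"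
  using M.l_one carrier_eq by (simp add: lambda_map_def one_eq[symmetric]) (simp add: one_eq)

lemma lambda_map_auto:
  assumes a: "a \<in> carrier A"
  shows "lambda_map A M a \<in> auto A"
proof -
  have i: "inv\<^bsub>M\<^esub> a \<in> carrier A" using M.inv_closed a carrier_eq by simp
  have "bij_betw (lambda_map A M a) (carrier A) (carrier A)"
  proof (rule bij_betw_byWitness[where f' = "lambda_map A M (inv\<^bsub>M\<^esub> a)"])
    show "\<forall>b\<in>carrier A. lambda_map A M (inv\<^bsub>M\<^esub> a) (lambda_map A M a b) = b"
      using a i M.l_inv carrier_eq by (simp add: lambda_map_mult[symmetric] lambda_map_one)
    show "\<forall>b\<in>carrier A. lambda_map A M a (lambda_map A M (inv\<^bsub>M\<^esub> a) b) = b"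
      using a i M.r_inv carrier_eq by (simp add: lambda_map_mult[symmetric] lambda_map_one)
  qed (use a i lambda_map_closed in auto)
  moreover have "lambda_map A M a \<in> extensional (carrier A)"
    by (simp add: lambda_map_def)
  ultimately show ?thesis
    using a by (auto simp: auto_def Bij_def hom_def lambda_map_add lambda_map_closed)
qed

lemma lambda_map_hom: "lambda_map A M \<in> hom M (AutoGroup A)"
proof -
  have "lambda_map A M (a \<otimes>\<^bsub>M\<^esub> b) = compose (carrier A) (lambda_map A M a) (lambda_map A M b)"
    if "a \<in> carrier A" "b \<in> carrier A" for a b
    using that
    by (intro extensionalityI[where A = "carrier A"])
       (auto simp: compose_eq lambda_map_mult, simp add: lambda_map_def)
  then show ?thesis
    using lambda_map_auto carrier_eq
    by (auto simp: hom_def AutoGroup_def BijGroup_def auto_def)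
qed

end

end

theory Submission
  imports Defs "HOL-Algebra.Sylow" "HOL-Algebra.Group_Action" "HOL-Algebra.SndIsomorphismGrp"
    "HOL-Algebra.Multiplicative_Group"
begin

text \<open>
  Write $B$ for the skew brace. Since $a \circ b = a + \lambda_a(b)$, a subgroup $D$ of $(B,+)$ that is
  mapped into itself by $\lambda_c$ for all $c$ in a subgroup $C \supseteq D$ of $(B,\circ)$ is automatically
  a sub-skew brace. So one looks for Hall $\pi$-subgroups of $(B,+)$ that are stable under many $\lambda_c$.
  Suppose that $C$ is a sub-skew brace of $\pi'$-index containing $S$ whose image $\lambda(C)$ is a
  $\pi$-group. Then $S \rtimes \lambda(C)$ is a $\pi$-subgroup of $(C,+) \rtimes \lambda(C)$, because the left
  ideal $S$ is stable under $\lambda$. A Hall $\pi$-subgroup containing it meets $(C,+)$ in a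
  $C$-stable Hall $\pi$-subgroup $D \supseteq S$, and $D$ is the required sub-skew brace.

  This uses only that every $\pi$-subgroup of a finite group lies in a Hall $\pi$-subgroup, which is true
  if $\pi = \{p\}$ (Sylow) or if the group is soluble (Hall). The Sylow case is a fixed point count. In the
  soluble case one descends the derived series, and each step is a Schur-Zassenhaus
  theorem for an abelian normal subgroup, in a form where the complement contains a prescribed subgroup
  (\<open>abelian_complement_containing\<close>).

  The three hypotheses serve to reach a $\pi$-group $\lambda(C)$. The argument above also works modulo a
  normal subgroup $J$: if a normal subgroup $R$ of $(B,\circ)$ satisfies
  $R \ast B \subseteq J$, then it acts trivially modulo $J$, so it is enough that
  $|C : R|$ is a $\pi$-number, and one obtains $D \supseteq J$ for which $|D : J|$ is a $\pi$-number
  (\<open>refine_sub_skew_brace\<close>). If $B$ is right nilpotent, one goes down the series $R_1, R_2, \ldots$ in this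
  way. A $\lambda$-homomorphic skew brace is right nilpotent with $R_3 = 0$. If $B$ is a bi-skew brace, then
  $\lambda_{a+b} = \lambda_{b \circ a}$, so every subgroup of $(B,\circ)$ that contains
  $K = \ker \lambda$ is a sub-skew brace. One can take for $C$ the preimage of a Hall $\pi$-subgroup of
  $(B,\circ)/K$, and a single step with $R = K$ and $J = 0$ finishes the proof.
\<close>

section \<open>Numbers with prescribed prime divisors\<close>

lemma pi_number_mult: "pi_number \<pi> (a * b) \<longleftrightarrow> pi_number \<pi> a \<and> pi_number \<pi> b"
  unfolding pi_number_def using prime_dvd_mult_iff by auto

lemma pi_number_one: "pi_number \<pi> 1"
  by (simp add: pi_number_def)

lemma pi_number_div: "pi_number \<pi> n \<Longrightarrow> m dvd n \<Longrightarrow> pi_number \<pi> (n div m)"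
  by (auto simp: pi_number_mult pi_number_def elim!: dvdE)

lemma pi_number_power: "pi_number \<pi> a \<Longrightarrow> pi_number \<pi> (a ^ k)"
  by (induction k) (auto simp: pi_number_mult pi_number_one[unfolded One_nat_def])

lemma coprime_if_pi_number_compl:
  assumes "pi_number \<pi> a" "pi_number (- \<pi>) b"
  shows "coprime a b"
proof (rule ccontr)
  assume "\<not> coprime a b"
  then have "gcd a b \<noteq> 1" by (simp add: coprime_iff_gcd_eq_1)
  then obtain q where "prime q" "q dvd gcd a b" using prime_factor_nat by blast
  then show False using assms unfolding pi_number_def by auto
qed

lemma pi_part_exists:
  assumes "n > (0::nat)"
  shows "\<exists>a b. n = a * b \<and> pi_number \<pi> a \<and> pi_number (- \<pi>) b"
  using assms
proof (induction n rule: less_induct)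
  case (less n)
  show ?case
  proof (cases "n = 1")
    case True
    then show ?thesis using pi_number_one by (metis mult_1)
  next
    case False
    then obtain q where q: "prime q" "q dvd n" using prime_factor_nat by blast
    then obtain m where m: "n = q * m" by blast
    then have "m < n" "m > 0" using less.prems prime_gt_1_nat[OF q(1)] by auto
    then obtain a b where ab: "m = a * b" "pi_number \<pi> a" "pi_number (- \<pi>) b"
      using less.IH by blast
    have "pi_number \<pi> q \<or> pi_number (- \<pi>) q"
      using q(1) by (cases "q \<in> \<pi>") (auto simp: pi_number_def prime_gt_0_nat dest: primes_dvd_imp_eq)
    then show ?thesis
    proof
      assume "pi_number \<pi> q"
      then show ?thesis using ab m
        by (intro exI[of _ "q * a"] exI[of _ b]) (auto simp: pi_number_mult)
    next
      assume "pi_number (- \<pi>) q"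
      then show ?thesis using ab m
        by (intro exI[of _ a] exI[of _ "q * b"]) (auto simp: pi_number_mult)
    qed
  qed
qed

lemma pi_number_singleton_iff:
  assumes "prime p"
  shows "pi_number {p} n \<longleftrightarrow> (\<exists>k. n = p ^ k)"
proof
  assume *: "pi_number {p} n"
  have "n > 0" using * by (simp add: pi_number_def)
  then show "\<exists>k. n = p ^ k" using *
  proof (induction n rule: less_induct)
    case (less n)
    show ?case
    proof (cases "n = 1")
      case True
      then show ?thesis by (intro exI[of _ 0]) simp
    next
      case False
      then obtain q where q: "prime q" "q dvd n" using prime_factor_nat by blast
      then have "q = p" using less.prems by (auto simp: pi_number_def)
      then obtain m where m: "n = p * m" using q by blast
      then have "m < n" "m > 0" "pi_number {p} m"
        using less.prems prime_gt_1_nat[OF assms] by (auto simp: pi_number_mult)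
      then obtain k where "m = p ^ k" using less.IH by blast
      then show ?thesis using m by (intro exI[of _ "Suc k"]) simp
    qed
  qed
next
  assume "\<exists>k. n = p ^ k"
  moreover have "pi_number {p} p"
    using assms by (auto simp: pi_number_def prime_gt_0_nat primes_dvd_imp_eq)
  ultimately show "pi_number {p} n" using pi_number_power by blast
qed

text \<open>A $\pi$-divisor of $n$ is coprime to $n / h$, so it divides $h$.\<close>

lemma Max_pi_divisor:
  assumes "h dvd n" "pi_number \<pi> h" "pi_number (- \<pi>) (n div h)"
  shows "Max {m. m dvd n \<and> pi_number \<pi> m} = h"
proof (rule Max_eqI)
  have n: "n = h * (n div h)" using assms(1) by simp
  have "n > 0" using assms(2,3) n by (metis nat_0_less_mult_iff pi_number_def)
  then show "finite {m. m dvd n \<and> pi_number \<pi> m}"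
    by (auto intro: finite_subset[of _ "{..n}"] dvd_imp_le)
  fix m assume "m \<in> {m. m dvd n \<and> pi_number \<pi> m}"
  then have m: "m dvd n" "pi_number \<pi> m" by auto
  have "coprime m (n div h)" using m(2) assms(3) by (rule coprime_if_pi_number_compl)
  then have "m dvd h" using m(1) n by (metis coprime_dvd_mult_left_iff)
  then show "m \<le> h" using assms(2) by (auto simp: pi_number_def intro: dvd_imp_le)
qed (use assms in auto)

section \<open>Orders of subgroups and images\<close>

lemma (in group) card_subgroup_dvd:
  assumes "subgroup H G" "subgroup K G" "H \<subseteq> K"
  shows "card H dvd card K"
proof -
  interpret K: group "G\<lparr>carrier := K\<rparr>" using assms(2) by (rule subgroup_imp_group)
  have "subgroup H (G\<lparr>carrier := K\<rparr>)" using assms by (intro subgroup_incl)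
  then show ?thesis
    using K.lagrange[of H] dvd_triv_right[of "card H" "card (rcosets\<^bsub>G\<lparr>carrier := K\<rparr>\<^esub> H)"]
    by (simp add: order_def)
qed

lemma (in group_hom) card_image_times_card_kernel:
  "card (h ` carrier G) * card (kernel G H h) = order G"
proof -
  have s: "subgroup (h ` carrier G) H" by (rule img_is_subgroup)
  interpret I: group "H\<lparr>carrier := h ` carrier G\<rparr>" using s by (rule H.subgroup_imp_group)
  interpret r: group_hom G "H\<lparr>carrier := h ` carrier G\<rparr>" h
    by unfold_locales (auto simp: hom_def)
  have "(\<lambda>X. the_elem (h ` X)) \<in> iso (G Mod kernel G (H\<lparr>carrier := h ` carrier G\<rparr>) h)
      (H\<lparr>carrier := h ` carrier G\<rparr>)"
    by (rule r.FactGroup_iso_set) simp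
  then have "card (carrier (G Mod kernel G H h)) = card (h ` carrier G)"
    using iso_same_card[of "G Mod kernel G H h" "H\<lparr>carrier := h ` carrier G\<rparr>"]
    by (auto simp: is_iso_def kernel_def)
  then show ?thesis
    using G.lagrange[OF subgroup_kernel] by (simp add: FactGroup_def)
qed

lemma (in group) card_image_subgroup:
  assumes "group_hom G K h" "subgroup U G"
  shows "card (h ` U) * card (U \<inter> kernel G K h) = card U"
proof -
  interpret h: group_hom G K h by fact
  interpret U: group "G\<lparr>carrier := U\<rparr>" using assms(2) by (rule subgroup_imp_group)
  interpret r: group_hom "G\<lparr>carrier := U\<rparr>" K h
    using subgroup.subset[OF assms(2)] by unfold_locales (auto simp: hom_def subset_iff)
  have "kernel (G\<lparr>carrier := U\<rparr>) K h = U \<inter> kernel G K h"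
    using subgroup.subset[OF assms(2)] by (auto simp: kernel_def)
  then show ?thesis using r.card_image_times_card_kernel by (simp add: order_def)
qed

text \<open>By Cauchy's theorem every prime divisor of the order is the order of an element, so it divides
  the exponent.\<close>

lemma (in group) pi_number_order_if_exponent:
  assumes fin: "finite (carrier G)" and m: "pi_number \<pi> m"
    and exp: "\<And>x. x \<in> carrier G \<Longrightarrow> x [^] (m::nat) = \<one>"
  shows "pi_number \<pi> (order G)"
  unfolding pi_number_def
proof (intro conjI allI impI)
  show "order G > 0" using fin by (simp add: order_gt_0_iff_finite)
  fix q :: nat assume q: "prime q \<and> q dvd order G"
  then obtain r where r: "order G = q ^ 1 * r" by (metis dvd_def power_one_right)
  obtain H where H: "subgroup H G" "card H = q"
    using sylow_thm[OF _ is_group r fin] q by auto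
  interpret H: group "G\<lparr>carrier := H\<rparr>" using H(1) by (rule subgroup_imp_group)
  have "H \<noteq> {\<one>}" using H(2) q by (auto dest: prime_gt_1_nat)
  then obtain x where x: "x \<in> H" "x \<noteq> \<one>" using subgroup.one_closed[OF H(1)] by blast
  have xG: "x \<in> carrier G" using x(1) H(1) by (meson subgroup.mem_carrier)
  have "x [^] q = \<one>"
    using H.pow_order_eq_1[of x] x(1) H(2) by (simp add: order_def nat_pow_consistent[symmetric])
  then have "ord x dvd q" "ord x dvd m" using exp[OF xG] pow_eq_id[OF xG] by auto
  moreover have "ord x \<noteq> 1" using x(2) xG ord_eq_1 by blast
  ultimately have "q dvd m" using q by (metis prime_nat_iff)
  then show "q \<in> \<pi>" using m q by (auto simp: pi_number_def)
qed

section \<open>Complements of abelian normal subgroups\<close>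

lemma (in group) mult_inv_cancel:
  assumes "x \<in> carrier G" "y \<in> carrier G"
  shows "inv x \<otimes> (x \<otimes> y) = y" "x \<otimes> (inv x \<otimes> y) = y"
  using assms by (simp_all flip: m_assoc)

context normal
begin

lemma kernel_r_coset: "kernel G (G Mod H) (\<lambda>x. H #> x) = H"
proof -
  have "H #> x = H \<longleftrightarrow> x \<in> H" if "x \<in> carrier G" for x
    using that coset_join1 coset_join2 is_subgroup by metis
  then show ?thesis using subset by (auto simp: kernel_def)
qed

lemma r_coset_group_hom: "group_hom G (G Mod H) (\<lambda>x. H #> x)"
  by (simp add: group_hom_def group_hom_axioms_def is_group factorgroup_is_group r_coset_hom_Mod)

lemma l_coset_r_coset:
  assumes "g \<in> carrier G" "x \<in> carrier G"
  shows "g <# (H #> x) = H #> (g \<otimes> x)"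
proof -
  have "g <# (H #> x) = (H #> g) #> x"
    using assms coset_eq coset_assoc[OF assms subset] by simp
  then show ?thesis using assms subset by (simp add: coset_mult_assoc)
qed

lemma l_coset_rcosets:
  assumes "g \<in> carrier G" "C \<in> rcosets H"
  shows "g <# C \<in> rcosets H"
  using assms l_coset_r_coset by (auto simp: RCOSETS_def)

lemma rcosets_quotient_mem:
  assumes "C \<in> rcosets H" "a \<in> C" "b \<in> C"
  shows "a \<otimes> inv b \<in> H"
proof -
  obtain y where y: "y \<in> carrier G" "C = H #> y" using assms(1) by (auto simp: RCOSETS_def)
  then have b: "b \<in> carrier G" using assms(3) r_coset_subset_G subset by blast
  have "C = H #> b" using y assms(3) repr_independence is_subgroup by simp
  then show ?thesis using assms(2) b rcos_module_imp is_group by blast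
qed

lemma l_coset_bij:
  assumes "g \<in> carrier G"
  shows "bij_betw (\<lambda>C. g <# C) (rcosets H) (rcosets H)"
proof (rule bij_betw_byWitness[where f' = "\<lambda>C. inv g <# C"])
  show "\<forall>C\<in>rcosets H. inv g <# (g <# C) = C" "\<forall>C\<in>rcosets H. g <# (inv g <# C) = C"
    using assms rcosets_carrier[OF is_group] by (simp_all add: lcos_m_assoc lcos_mult_one)
  show "(\<lambda>C. g <# C) ` (rcosets H) \<subseteq> rcosets H" "(\<lambda>C. inv g <# C) ` (rcosets H) \<subseteq> rcosets H"
    using assms l_coset_rcosets by blast+
qed

lemma l_coset_absorb:
  assumes "n \<in> H" "C \<in> rcosets H"
  shows "n <# C = C"
proof -
  obtain y where y: "y \<in> carrier G" "C = H #> y" using assms(2) by (auto simp: RCOSETS_def)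
  have "n \<otimes> y \<in> H #> y" using assms(1) y(1) rcosI subset by blast
  then have "H #> (n \<otimes> y) = H #> y" using y(1) repr_independence is_subgroup by metis
  then show ?thesis using assms y l_coset_r_coset by simp
qed

text \<open>A subgroup \<open>U\<close> meeting \<^term>\<open>H\<close> trivially permutes the cosets of \<^term>\<open>H\<close> freely by left
  multiplication, so representatives can be chosen on one coset per orbit and transported. The
  union of an orbit is a coset of \<^term>\<open>H <#> U\<close>.\<close>

lemma equivariant_section:
  assumes U: "subgroup U G" and triv: "U \<inter> H = {\<one>}"
  obtains r where "\<And>C. C \<in> rcosets H \<Longrightarrow> r C \<in> C"
    and "\<And>u C. u \<in> U \<Longrightarrow> C \<in> rcosets H \<Longrightarrow> r (u <# C) = u \<otimes> r C"
proof -
  interpret U: subgroup U G by fact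
  interpret s: second_isomorphism_grp H G U by unfold_locales
  define V where "V = H <#> U"
  have V: "subgroup V G" unfolding V_def by (rule s.normal_set_mult_subgroup)
  have HV: "H \<subseteq> V" and UV: "U \<subseteq> V"
    unfolding V_def using s.H_contained_in_set_mult s.S_contained_in_set_mult by auto
  define rep where "rep K = (SOME z. z \<in> K)" for K :: "'a set"
  have rep: "rep K \<in> K" "rep K \<in> carrier G" "K = V #> rep K" if K: "K \<in> rcosets V" for K
  proof -
    show 1: "rep K \<in> K" unfolding rep_def
      using subgroup.rcosets_non_empty[OF V K] by (simp add: some_in_eq)
    then show 2: "rep K \<in> carrier G"
      using 1 subgroup.rcosets_carrier[OF V is_group K] by blast
    obtain y where "y \<in> carrier G" "K = V #> y" using K by (auto simp: RCOSETS_def)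
    then show "K = V #> rep K" using 1 V repr_independence by simp
  qed
  define T where "T = {u \<otimes> rep K |u K. u \<in> U \<and> K \<in> rcosets V}"
  have TG: "T \<subseteq> carrier G" using rep(2) by (auto simp: T_def)
  have UT: "u \<otimes> t \<in> T" if "u \<in> U" "t \<in> T" for u t
  proof -
    obtain v K where vK: "t = v \<otimes> rep K" "v \<in> U" "K \<in> rcosets V" using \<open>t \<in> T\<close> by (auto simp: T_def)
    then have "u \<otimes> t = (u \<otimes> v) \<otimes> rep K" using that rep(2) by (simp add: m_assoc)
    then show ?thesis using vK that U.m_closed unfolding T_def by blast
  qed
  have uniq: "t = t'" if "t \<in> T" "t' \<in> T" "t \<otimes> inv t' \<in> H" for t t'
  proof -
    obtain u K where t: "t = u \<otimes> rep K" "u \<in> U" "K \<in> rcosets V" using \<open>t \<in> T\<close> by (auto simp: T_def)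
    obtain u' K' where t': "t' = u' \<otimes> rep K'" "u' \<in> U" "K' \<in> rcosets V"
      using \<open>t' \<in> T\<close> by (auto simp: T_def)
    have car: "u \<in> carrier G" "u' \<in> carrier G" "rep K \<in> carrier G" "rep K' \<in> carrier G"
      "t \<in> carrier G" "t' \<in> carrier G"
      using t t' rep(2) that TG by auto
    have "rep K = inv u \<otimes> (t \<otimes> inv t') \<otimes> u' \<otimes> rep K'"
      using car by (simp add: t(1) t'(1) inv_mult_group m_assoc mult_inv_cancel)
    moreover have "inv u \<otimes> (t \<otimes> inv t') \<otimes> u' \<in> V"
      using t(2) t'(2) that(3) HV UV V by (meson subgroup.m_closed subgroup.m_inv_closed subsetD)
    ultimately have "rep K \<in> V #> rep K'" using rcosI[of _ V] car V subgroup.subset by metis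
    then have "V #> rep K' = V #> rep K" using car V repr_independence by metis
    then have KK: "K = K'" using rep(3) t(3) t'(3) by metis
    then have "t \<otimes> inv t' = u \<otimes> inv u'"
      using car by (simp add: t(1) t'(1) inv_mult_group m_assoc mult_inv_cancel)
    then have "u \<otimes> inv u' \<in> U \<inter> H" using that(3) t t' by auto
    then have "u \<otimes> inv u' = \<one>" using triv by blast
    then have "u = u'" using car by (metis inv_equality inv_inv inv_closed)
    then show ?thesis using KK t(1) t'(1) by simp
  qed
  have ex: "\<exists>t\<in>T. t \<in> C" if C: "C \<in> rcosets H" for C
  proof -
    obtain x where x: "x \<in> carrier G" "C = H #> x" using C by (auto simp: RCOSETS_def)
    define K where "K = V #> x"
    have K: "K \<in> rcosets V" unfolding K_def using x V subgroup.subset rcosetsI by metis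
    have "x \<in> V #> rep K" using rep(3)[OF K] x V rcos_self unfolding K_def by metis
    then obtain h u where hu: "h \<in> H" "u \<in> U" "x = h \<otimes> u \<otimes> rep K"
      by (auto simp: r_coset_def V_def set_mult_def)
    have car: "h \<in> carrier G" "u \<in> carrier G" "rep K \<in> carrier G" using hu rep(2)[OF K] by auto
    then have "u \<otimes> rep K = inv h \<otimes> x" using hu(3) by (simp add: m_assoc mult_inv_cancel)
    then have "u \<otimes> rep K \<in> C" using hu(1) x by (auto simp: r_coset_def)
    then show ?thesis using hu(2) K unfolding T_def by blast
  qed
  define r where "r C = (SOME t. t \<in> T \<and> t \<in> C)" for C
  have r: "r C \<in> T" "r C \<in> C" if "C \<in> rcosets H" for C
    using someI_ex[of "\<lambda>t. t \<in> T \<and> t \<in> C"] ex[OF that] unfolding r_def by auto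
  have "r (u <# C) = u \<otimes> r C" if u: "u \<in> U" and C: "C \<in> rcosets H" for u C
  proof -
    have uC: "u <# C \<in> rcosets H" using u C l_coset_rcosets by auto
    have "u \<otimes> r C \<in> u <# C" using r(2)[OF C] by (auto simp: l_coset_def)
    then have "r (u <# C) \<otimes> inv (u \<otimes> r C) \<in> H" using rcosets_quotient_mem[OF uC] r(2)[OF uC] by blast
    then show ?thesis using uniq r(1)[OF uC] UT[OF u r(1)[OF C]] by blast
  qed
  then show thesis using that r(2) by blast
qed

text \<open>Compare a section \<open>r\<close> of the quotient map with its translates: the product of all
  \<open>g \<otimes> r C \<otimes> inv (r (g <# C))\<close> is a crossed homomorphism \<open>f\<close> into the abelian group \<^term>\<open>H\<close>,
  which on \<^term>\<open>H\<close> itself is the power map by the index, a bijection by coprimality. Hence the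
  kernel of \<open>f\<close> is a complement. If \<open>r\<close> is equivariant under \<open>U\<close>, every factor is trivial
  for \<open>g\<close> in \<open>U\<close>, so the complement contains \<open>U\<close>.\<close>

theorem abelian_complement_containing:
  assumes fin: "finite (carrier G)"
    and comm: "\<And>x y. x \<in> H \<Longrightarrow> y \<in> H \<Longrightarrow> x \<otimes> y = y \<otimes> x"
    and cop: "coprime (card (rcosets H)) (card H)"
    and U: "subgroup U G" and triv: "U \<inter> H = {\<one>}"
  shows "\<exists>K. subgroup K G \<and> U \<subseteq> K \<and> card K = card (rcosets H)"
proof -
  interpret U: subgroup U G by fact
  obtain r where rC: "\<And>C. C \<in> rcosets H \<Longrightarrow> r C \<in> C"
    and rU: "\<And>u C. u \<in> U \<Longrightarrow> C \<in> rcosets H \<Longrightarrow> r (u <# C) = u \<otimes> r C"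
    using equivariant_section[OF U triv] by blast
  have rG: "r C \<in> carrier G" if "C \<in> rcosets H" for C
    using rC[OF that] rcosets_carrier[OF is_group that] by blast
  interpret H: comm_group "G\<lparr>carrier := H\<rparr>"
    using subgroup_imp_group[OF is_subgroup] comm by (intro group.group_comm_groupI) auto
  define c where "c g C = g \<otimes> r C \<otimes> inv (r (g <# C))" for g C
  define f where "f g = finprod (G\<lparr>carrier := H\<rparr>) (c g) (rcosets H)" for g
  define m where "m = card (rcosets H)"
  have finQ: "finite (rcosets H)"
    using fin rcosets_subset_PowG[OF is_subgroup] by (meson finite_Pow_iff finite_subset)
  have cH: "c g C \<in> H" if "g \<in> carrier G" "C \<in> rcosets H" for g C
  proof -
    have "g \<otimes> r C \<in> g <# C" using rC[OF that(2)] by (auto simp: l_coset_def)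
    then show ?thesis unfolding c_def
      using rcosets_quotient_mem[OF l_coset_rcosets[OF that]] rC[OF l_coset_rcosets[OF that]] by blast
  qed
  have fH: "f g \<in> H" if "g \<in> carrier G" for g
    using H.finprod_closed[of "c g" "rcosets H"] cH[OF that] unfolding f_def by auto
  have conj: "finprod (G\<lparr>carrier := H\<rparr>) (\<lambda>C. g \<otimes> d C \<otimes> inv g) S
      = g \<otimes> finprod (G\<lparr>carrier := H\<rparr>) d S \<otimes> inv g"
    if "finite S" "g \<in> carrier G" "d \<in> S \<rightarrow> H" for g d and S :: "'a set set"
    using that
  proof (induction S)
    case empty
    then show ?case by simp
  next
    case (insert C S)
    have d: "d C \<in> H" "d \<in> S \<rightarrow> H" using insert.prems by auto
    have P: "finprod (G\<lparr>carrier := H\<rparr>) d S \<in> H" using H.finprod_closed[of d S] d by auto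
    have "finprod (G\<lparr>carrier := H\<rparr>) (\<lambda>C. g \<otimes> d C \<otimes> inv g) (insert C S)
        = (g \<otimes> d C \<otimes> inv g) \<otimes> (g \<otimes> finprod (G\<lparr>carrier := H\<rparr>) d S \<otimes> inv g)"
      using insert d inv_op_closed2 by (subst H.finprod_insert) (auto simp: Pi_iff)
    also have "\<dots> = g \<otimes> (d C \<otimes> finprod (G\<lparr>carrier := H\<rparr>) d S) \<otimes> inv g"
      using P d(1) insert.prems(1) by (simp add: m_assoc mult_inv_cancel)
    finally show ?case using insert d by (subst H.finprod_insert) auto
  qed
  have cross: "f (g \<otimes> h) = (g \<otimes> f h \<otimes> inv g) \<otimes> f g" if g: "g \<in> carrier G" and h: "h \<in> carrier G" for g h
  proof -
    have "c (g \<otimes> h) C = (g \<otimes> c h C \<otimes> inv g) \<otimes> c g (h <# C)" if C: "C \<in> rcosets H" for C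
    proof -
      have "(g \<otimes> h) <# C = g <# (h <# C)"
        using g h C rcosets_carrier[OF is_group C] by (simp add: lcos_m_assoc)
      then show ?thesis unfolding c_def
        using g h rG[OF C] rG[OF l_coset_rcosets[OF h C]]
          rG[OF l_coset_rcosets[OF g l_coset_rcosets[OF h C]]]
        by (simp add: m_assoc mult_inv_cancel)
    qed
    then have "f (g \<otimes> h) = finprod (G\<lparr>carrier := H\<rparr>)
        (\<lambda>C. (g \<otimes> c h C \<otimes> inv g) \<otimes>\<^bsub>G\<lparr>carrier := H\<rparr>\<^esub> c g (h <# C)) (rcosets H)"
      unfolding f_def using cH[of "g \<otimes> h"] g h cH[of g] cH[of h] l_coset_rcosets inv_op_closed2
      by (intro H.finprod_cong') (auto simp: Pi_iff)
    also have "\<dots> = finprod (G\<lparr>carrier := H\<rparr>) (\<lambda>C. g \<otimes> c h C \<otimes> inv g) (rcosets H)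
        \<otimes> finprod (G\<lparr>carrier := H\<rparr>) (\<lambda>C. c g (h <# C)) (rcosets H)"
      using cH[OF g] cH[OF h] l_coset_rcosets[OF h] inv_op_closed2[OF g]
      by (subst H.finprod_multf) (auto simp: Pi_iff)
    also have "finprod (G\<lparr>carrier := H\<rparr>) (\<lambda>C. c g (h <# C)) (rcosets H) = f g"
    proof -
      have "finprod (G\<lparr>carrier := H\<rparr>) (c g) ((\<lambda>C. h <# C) ` (rcosets H))
          = finprod (G\<lparr>carrier := H\<rparr>) (\<lambda>C. c g (h <# C)) (rcosets H)"
        using cH[OF g] l_coset_rcosets[OF h] l_coset_bij[OF h]
        by (intro H.finprod_reindex) (auto simp: bij_betw_def)
      then show ?thesis using l_coset_bij[OF h] unfolding f_def bij_betw_def by simp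
    qed
    also have "finprod (G\<lparr>carrier := H\<rparr>) (\<lambda>C. g \<otimes> c h C \<otimes> inv g) (rcosets H) = g \<otimes> f h \<otimes> inv g"
      unfolding f_def using conj[OF finQ g, of "c h"] cH[OF h] by auto
    finally show ?thesis .
  qed
  have fU: "f u = \<one>" if "u \<in> U" for u
  proof -
    have "c u C = \<one>" if "C \<in> rcosets H" for C
      unfolding c_def using that \<open>u \<in> U\<close> rU[OF \<open>u \<in> U\<close> that] rG[OF that] by simp
    then have "f u = finprod (G\<lparr>carrier := H\<rparr>) (\<lambda>_. \<one>\<^bsub>G\<lparr>carrier := H\<rparr>\<^esub>) (rcosets H)"
      unfolding f_def by (intro H.finprod_cong') auto
    also have "\<dots> = \<one>" by (subst H.finprod_one) simp
    finally show ?thesis .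
  qed
  have fn: "f n = n [^] m" if "n \<in> H" for n
  proof -
    have "c n C = n" if "C \<in> rcosets H" for C
      unfolding c_def using l_coset_absorb[OF \<open>n \<in> H\<close> that] rG[OF that] \<open>n \<in> H\<close> by (simp add: m_assoc)
    then have "f n = finprod (G\<lparr>carrier := H\<rparr>) (\<lambda>_. n) (rcosets H)"
      unfolding f_def using that by (intro H.finprod_cong') auto
    also have "\<dots> = n [^] m"
      using that H.finprod_const[of n "rcosets H"] by (simp add: m_def nat_pow_consistent[symmetric])
    finally show ?thesis .
  qed
  have one: "f \<one> = \<one>" using fU U.one_closed by blast
  define K where "K = {g \<in> carrier G. f g = \<one>}"
  have K: "subgroup K G"
  proof (rule subgroupI)
    show "K \<noteq> {}" using one by (auto simp: K_def)
    fix g assume g: "g \<in> K"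
    then have gG: "g \<in> carrier G" "f g = \<one>" by (auto simp: K_def)
    have "f (inv g \<otimes> g) = (inv g \<otimes> f g \<otimes> inv (inv g)) \<otimes> f (inv g)" using gG by (intro cross) auto
    then have "f (inv g) = \<one>" using gG one fH[of "inv g"] by simp
    then show "inv g \<in> K" using gG by (simp add: K_def)
    fix h assume h: "h \<in> K"
    then show "g \<otimes> h \<in> K" using gG cross[of g h] by (auto simp: K_def)
  qed (auto simp: K_def)
  have "card H \<noteq> 0" using fin by (metis is_subgroup finite_imp_card_positive less_not_refl)
  have powN: "n [^] card H = \<one>" if "n \<in> H" for n
    using H.pow_order_eq_1[of n] that by (simp add: order_def nat_pow_consistent[symmetric])
  have m0: "m \<noteq> 0"
    using finQ subgroup_in_rcosets[OF is_group] unfolding m_def by auto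
  then obtain a b where ab: "m * a = card H * b + 1"
    using bezout_add_strong_nat[of m "card H"] cop unfolding m_def
    by (metis coprime_common_divisor_nat)
  have powab: "(n [^] m) [^] a = n" if "n \<in> H" for n
  proof -
    have "(n [^] m) [^] a = (n [^] card H) [^] b \<otimes> n"
      using that by (simp add: nat_pow_pow ab) 
    then show ?thesis using that powN by (simp add: nat_pow_pow)
  qed
  have KH: "K \<inter> H = {\<one>}"
    using powab fn K subgroup.one_closed one_closed by (fastforce simp: K_def)
  have img: "(\<lambda>x. H #> x) ` K = rcosets H"
  proof
    show "(\<lambda>x. H #> x) ` K \<subseteq> rcosets H" by (auto simp: K_def RCOSETS_def)
    show "rcosets H \<subseteq> (\<lambda>x. H #> x) ` K"
    proof
      fix C assume "C \<in> rcosets H"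
      then obtain x where x: "x \<in> carrier G" "C = H #> x" by (auto simp: RCOSETS_def)
      \<comment> \<open>As \<open>f (n \<otimes> x) = f x \<otimes> n [^] m\<close> for \<open>n\<close> in \<^term>\<open>H\<close>, an \<open>m\<close>-th root of \<open>inv (f x)\<close> moves
        \<open>x\<close> into the kernel without leaving its coset; \<open>a\<close> inverts \<open>m\<close> modulo the order of \<^term>\<open>H\<close>.\<close>
      define n where "n = (inv (f x)) [^] a"
      have fx: "f x \<in> H" "f x \<in> carrier G" using fH x(1) by auto
      have nH: "n \<in> H" unfolding n_def
        using fx H.nat_pow_closed[of "inv (f x)" a] by (simp add: nat_pow_consistent[symmetric])
      have "n [^] m = inv (f x)"
        using powab[of "inv (f x)"] fx unfolding n_def by (simp add: nat_pow_pow mult.commute)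
      then have "f n = inv (f x)" using fn nH by simp
      then have "f (n \<otimes> x) = n \<otimes> f x \<otimes> inv n \<otimes> inv (f x)" using cross[of n x] nH x(1) by simp
      also have "n \<otimes> f x = f x \<otimes> n" using comm nH fx(1) by blast
      finally have "f (n \<otimes> x) = \<one>" using nH fx by (simp add: m_assoc)
      then have "n \<otimes> x \<in> K" using nH x(1) by (simp add: K_def)
      moreover have "H #> (n \<otimes> x) = C" using nH x by (metis coset_mult_assoc rcos_const is_group mem_carrier subset)
      ultimately show "C \<in> (\<lambda>x. H #> x) ` K" by blast
    qed
  qed
  have "card K = card (rcosets H)"
    using card_image_subgroup[OF r_coset_group_hom K] img KH by (simp add: kernel_r_coset)
  moreover have "U \<subseteq> K" using fU by (auto simp: K_def)
  ultimately show ?thesis using K by blast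
qed

end

section \<open>Dominance of Hall subgroups\<close>

definition hall_dominant :: "nat set \<Rightarrow> ('a, 'b) monoid_scheme \<Rightarrow> bool"
  where "hall_dominant \<pi> G \<longleftrightarrow>
    (\<forall>U. subgroup U G \<longrightarrow> pi_number \<pi> (card U) \<longrightarrow>
      (\<exists>T. subgroup T G \<and> U \<subseteq> T \<and> pi_number \<pi> (card T) \<and> pi_number (- \<pi>) (order G div card T)))"

text \<open>Write the order of the abelian normal subgroup \<^term>\<open>H\<close> as \<open>m * m'\<close> with a $\pi$-number \<open>m\<close> and a
  $\pi'$-number \<open>m'\<close>. The kernel \<open>B\<close> of the power map by \<open>m'\<close> is the $\pi'$-part of \<^term>\<open>H\<close> and normal in
  the whole group, and its index is a $\pi$-number. A complement of \<open>B\<close> is therefore a Hall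
  $\pi$-subgroup, and every $\pi$-subgroup meets \<open>B\<close> trivially, so it lies in such a complement.\<close>

lemma (in normal) hall_dominant_if_abelian:
  assumes fin: "finite (carrier G)"
    and comm: "\<And>x y. x \<in> H \<Longrightarrow> y \<in> H \<Longrightarrow> x \<otimes> y = y \<otimes> x"
    and index: "pi_number \<pi> (card (rcosets H))"
  shows "hall_dominant \<pi> G"
proof -
  have finH: "finite H" using fin subset by (rule rev_finite_subset)
  then have "card H > 0" using fin finite_imp_card_positive by blast
  then obtain m m' where m: "card H = m * m'" "pi_number \<pi> m" "pi_number (- \<pi>) m'"
    using pi_part_exists by blast
  interpret H: comm_group "G\<lparr>carrier := H\<rparr>"
    using subgroup_imp_group[OF is_subgroup] comm by (intro group.group_comm_groupI) auto
  define B where "B = {a \<in> H. a [^] m' = \<one>}"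
  interpret pow: group_hom "G\<lparr>carrier := H\<rparr>" "G\<lparr>carrier := H\<rparr>" "\<lambda>a. a [^] m'"
  proof unfold_locales
    show "(\<lambda>a. a [^] m') \<in> hom (G\<lparr>carrier := H\<rparr>) (G\<lparr>carrier := H\<rparr>)"
      using H.nat_pow_closed H.nat_pow_distrib[of _ _ m']
      by (auto simp: hom_def nat_pow_consistent[symmetric])
  qed
  have ker: "kernel (G\<lparr>carrier := H\<rparr>) (G\<lparr>carrier := H\<rparr>) (\<lambda>a. a [^] m') = B"
    by (auto simp: kernel_def B_def)
  have BH: "subgroup B (G\<lparr>carrier := H\<rparr>)"
    using pow.subgroup_kernel by (simp add: ker)
  then have B: "subgroup B G" using incl_subgroup is_subgroup by blast
  define I where "I = (\<lambda>a. a [^] m') ` H"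
  have cIB: "card I * card B = card H"
    using pow.card_image_times_card_kernel by (simp add: ker order_def I_def)
  have "subgroup I (G\<lparr>carrier := H\<rparr>)"
    using pow.img_is_subgroup by (simp add: I_def)
  then have I: "subgroup I G" using incl_subgroup is_subgroup by blast
  have "pi_number \<pi> (order (G\<lparr>carrier := I\<rparr>))"
  proof (rule group.pi_number_order_if_exponent[OF subgroup_imp_group[OF I] _ m(2)])
    show "finite (carrier (G\<lparr>carrier := I\<rparr>))" using finH by (simp add: I_def)
    fix x assume "x \<in> carrier (G\<lparr>carrier := I\<rparr>)"
    then obtain a where a: "a \<in> H" "x = a [^] m'" by (auto simp: I_def)
    then have "x [^] m = a [^] card H" by (simp add: m(1) nat_pow_pow mult.commute)
    also have "\<dots> = \<one>"
      using H.pow_order_eq_1[of a] a(1) by (simp add: order_def nat_pow_consistent[symmetric])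
    finally show "x [^]\<^bsub>G\<lparr>carrier := I\<rparr>\<^esub> m = \<one>\<^bsub>G\<lparr>carrier := I\<rparr>\<^esub>"
      by (simp add: nat_pow_consistent[symmetric])
  qed
  then have piI: "pi_number \<pi> (card I)" by (simp add: order_def)
  have "pi_number (- \<pi>) (order (G\<lparr>carrier := B\<rparr>))"
  proof (rule group.pi_number_order_if_exponent[OF subgroup_imp_group[OF B] _ m(3)])
    show "finite (carrier (G\<lparr>carrier := B\<rparr>))" using finH by (simp add: B_def)
  qed (auto simp: B_def nat_pow_consistent[symmetric])
  then have piB: "pi_number (- \<pi>) (card B)" by (simp add: order_def)
  have "B \<lhd> G"
  proof (rule normal_invI[OF B])
    fix x h assume x: "x \<in> carrier G" and h: "h \<in> B"
    then have hH: "h \<in> H" "h [^] m' = \<one>" by (auto simp: B_def)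
    have "(x \<otimes> h \<otimes> inv x) [^] k = x \<otimes> h [^] k \<otimes> inv x" for k :: nat
      using x hH(1) by (induction k) (auto simp: m_assoc mult_inv_cancel)
    then show "x \<otimes> h \<otimes> inv x \<in> B" using x hH inv_op_closed2[OF x hH(1)] by (simp add: B_def)
  qed
  then interpret B: normal B G .
  have "card (rcosets B) * card B = (card (rcosets H) * card I) * card B"
    using lagrange[OF B] lagrange[OF is_subgroup] cIB by (simp add: mult.assoc)
  moreover have B0: "card B > 0" using piB by (simp add: pi_number_def)
  ultimately have cB: "card (rcosets B) = card (rcosets H) * card I" by simp
  then have piQ: "pi_number \<pi> (card (rcosets B))" using index piI by (simp add: pi_number_mult)
  have BHs: "B \<subseteq> H" by (auto simp: B_def)
  show ?thesis unfolding hall_dominant_def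
  proof (intro allI impI)
    fix U assume U: "subgroup U G" and piU: "pi_number \<pi> (card U)"
    have UB: "subgroup (U \<inter> B) G" using U B by (rule subgroups_Inter_pair)
    have "card (U \<inter> B) dvd card U" "card (U \<inter> B) dvd card B"
      using UB U B by (auto intro: card_subgroup_dvd)
    then have "card (U \<inter> B) = 1"
      using coprime_if_pi_number_compl[OF piU piB] coprime_common_divisor_nat by blast
    then have "U \<inter> B = {\<one>}" using subgroup.one_closed[OF UB] by (metis card_1_singletonE singletonD)
    then obtain K where K: "subgroup K G" "U \<subseteq> K" "card K = card (rcosets B)"
      using B.abelian_complement_containing[OF fin _ coprime_if_pi_number_compl[OF piQ piB] U]
        comm BHs by blast
    have "order G = card K * card B" using lagrange[OF B] K(3) by simp
    then have "order G div card K = card B"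
      using piQ K(3) by (simp add: pi_number_def)
    then show "\<exists>T. subgroup T G \<and> U \<subseteq> T \<and> pi_number \<pi> (card T) \<and> pi_number (- \<pi>) (order G div card T)"
      using K piQ piB by auto
  qed
qed

text \<open>The quotient of orders in the hypothesis is the order of the image of \<^term>\<open>U\<close> modulo \<^term>\<open>H\<close>. Its
  form spares the product of \<^term>\<open>U\<close> and \<^term>\<open>H\<close>.\<close>

lemma (in normal) pull_back_hall_dominant:
  assumes fin: "finite (carrier G)" and dom: "hall_dominant \<pi> (G Mod H)"
    and U: "subgroup U G" and piU: "pi_number \<pi> (card U div card (U \<inter> H))"
  shows "\<exists>T. subgroup T G \<and> U \<subseteq> T \<and> H \<subseteq> T \<and> pi_number \<pi> (card T div card H) \<and>
    pi_number (- \<pi>) (order G div card T)"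
proof -
  interpret q: group_hom G "G Mod H" "\<lambda>x. H #> x" by (rule r_coset_group_hom)
  interpret U: subgroup U G by fact
  have finH: "finite H" using fin subset by (rule rev_finite_subset)
  then have H0: "card H > 0" using fin finite_imp_card_positive by blast
  define X where "X = (\<lambda>x. H #> x) ` U"
  have X: "subgroup X (G Mod H)" unfolding X_def by (rule q.subgroup_img_is_subgroup[OF U])
  have "card X * card (U \<inter> H) = card U"
    using card_image_subgroup[OF r_coset_group_hom U] by (simp add: kernel_r_coset X_def)
  moreover have "\<one> \<in> U \<inter> H"
    using U.one_closed subgroup.one_closed[OF is_subgroup] by blast
  then have "card (U \<inter> H) > 0"
    using finH by (metis card_gt_0_iff empty_iff finite_Int)
  ultimately have "card X = card U div card (U \<inter> H)" by (metis nonzero_mult_div_cancel_right less_not_refl)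
  then obtain Y where Y: "subgroup Y (G Mod H)" "X \<subseteq> Y" "pi_number \<pi> (card Y)"
    "pi_number (- \<pi>) (order (G Mod H) div card Y)"
    using dom X piU unfolding hall_dominant_def by metis
  define T where "T = {x \<in> carrier G. H #> x \<in> Y}"
  have T: "subgroup T G"
    using factgroup_subgroup_union_subgroup[OF Y(1)] factgroup_subgroup_union_char[OF Y(1)]
    by (simp add: T_def)
  have UT: "U \<subseteq> T" using Y(2) U.subset by (auto simp: X_def T_def)
  have HT: "H \<subseteq> T"
  proof
    fix h assume h: "h \<in> H"
    then have "H #> h = \<one>\<^bsub>G Mod H\<^esub>" using rcos_const[OF is_group] by simp
    then show "h \<in> T" using h subgroup.one_closed[OF Y(1)] by (simp add: T_def)
  qed
  have "(\<lambda>x. H #> x) ` T = Y"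
    using subgroup.subset[OF Y(1)] by (auto simp: T_def carrier_FactGroup)
  then have cT: "card T = card Y * card H"
    using card_image_subgroup[OF r_coset_group_hom T] HT by (simp add: kernel_r_coset Int_absorb1)
  have oG: "order G = order (G Mod H) * card H"
    using lagrange[OF is_subgroup] by (simp add: FactGroup_def order_def)
  have "card T div card H = card Y" "order G div card T = order (G Mod H) div card Y"
    using H0 by (auto simp: cT oG)
  then show ?thesis using T UT HT Y(3,4) by auto
qed

lemma (in group) hall_dominant_section:
  assumes fin: "finite (carrier G)" and W: "subgroup W G" and N: "N \<lhd> G\<lparr>carrier := W\<rparr>"
    and dom: "hall_dominant \<pi> (G\<lparr>carrier := W\<rparr> Mod N)"
    and U: "subgroup U G" "U \<subseteq> W" and piU: "pi_number \<pi> (card U div card (U \<inter> N))"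
  shows "\<exists>T. subgroup T G \<and> U \<subseteq> T \<and> N \<subseteq> T \<and> T \<subseteq> W \<and> pi_number \<pi> (card T div card N) \<and>
    pi_number (- \<pi>) (card W div card T)"
proof -
  have "finite (carrier (G\<lparr>carrier := W\<rparr>))"
    using fin subgroup.subset[OF W] by (simp add: finite_subset)
  moreover have "subgroup U (G\<lparr>carrier := W\<rparr>)" using U W by (intro subgroup_incl)
  ultimately obtain T where T: "subgroup T (G\<lparr>carrier := W\<rparr>)" "U \<subseteq> T" "N \<subseteq> T"
      "pi_number \<pi> (card T div card N)" "pi_number (- \<pi>) (card W div card T)"
    using normal.pull_back_hall_dominant[OF N _ dom _ piU] by (auto simp: order_def)
  then show ?thesis using incl_subgroup[OF W T(1)] subgroup.subset[OF T(1)] by auto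
qed

text \<open>Let \<open>D i\<close> be the derived series. Starting with the whole group, one constructs a chain of
  subgroups \<open>T\<close> of $\pi'$-index, containing \<open>U\<close> and \<open>D i\<close>, in which \<open>D i\<close> has $\pi$-index. Modulo
  \<open>D (Suc i)\<close> the subgroup \<open>D i\<close> of \<open>T\<close> is abelian, so the abelian case yields the next term. Working with
  sections of one group, and not by induction on the order of quotients, keeps the type of
  the elements fixed.\<close>

theorem (in group) hall_dominant_if_solvable:
  assumes fin: "finite (carrier G)" and sol: "solvable G"
  shows "hall_dominant \<pi> G"
  unfolding hall_dominant_def
proof (intro allI impI)
  fix U assume U: "subgroup U G" and piU: "pi_number \<pi> (card U)"
  define D where "D i = (derived G ^^ i) (carrier G)" for i
  have D: "D i \<lhd> G" for i
    unfolding D_def by (induction i) (auto simp: normal_self derived_is_normal)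
  have DSuc: "D (Suc i) = derived G (D i)" for i by (simp add: D_def)
  have finsub: "finite X" if "X \<subseteq> carrier G" for X using fin that by (rule rev_finite_subset)
  have pos: "card X > 0" if "subgroup X G" for X
    using that fin subgroup.finite_imp_card_positive by blast
  have "\<exists>T. subgroup T G \<and> U \<subseteq> T \<and> D i \<subseteq> T \<and> pi_number \<pi> (card T div card (D i)) \<and>
      pi_number (- \<pi>) (order G div card T)" for i
  proof (induction i)
    case 0
    show ?case
      using subgroup_self subgroup.subset[OF U] pos[OF subgroup_self]
      by (intro exI[of _ "carrier G"]) (auto simp: D_def order_def pi_number_def)
  next
    case (Suc i)
    then obtain T where T: "subgroup T G" "U \<subseteq> T" "D i \<subseteq> T" "pi_number \<pi> (card T div card (D i))"
      "pi_number (- \<pi>) (order G div card T)" by blast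
    define N where "N = D (Suc i)"
    have ND: "N \<subseteq> D i" unfolding N_def DSuc using D normal_imp_subgroup by (intro derived_incl) auto
    have sD: "subgroup (D i) G" and sN: "subgroup N G"
      using D normal_imp_subgroup by (auto simp: N_def)
    have NT: "N \<lhd> G\<lparr>carrier := T\<rparr>"
      using D ND T by (auto simp: N_def intro!: normal_restrict_supergroup)
    then interpret N: normal N "G\<lparr>carrier := T\<rparr>" .
    interpret q: group_hom "G\<lparr>carrier := T\<rparr>" "G\<lparr>carrier := T\<rparr> Mod N" "\<lambda>x. N #>\<^bsub>G\<lparr>carrier := T\<rparr>\<^esub> x"
      by (rule N.r_coset_group_hom)
    define Q where "Q = (\<lambda>x. N #>\<^bsub>G\<lparr>carrier := T\<rparr>\<^esub> x) ` D i"
    have DT: "D i \<lhd> G\<lparr>carrier := T\<rparr>" using D T by (intro normal_restrict_supergroup)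
    have Q: "Q \<lhd> G\<lparr>carrier := T\<rparr> Mod N"
      unfolding Q_def
      by (rule normal.surj_hom_normal_subgroup[OF DT N.r_coset_group_hom])
         (auto simp: carrier_FactGroup)
    interpret Q: normal Q "G\<lparr>carrier := T\<rparr> Mod N" by (rule Q)
    have "hall_dominant \<pi> (G\<lparr>carrier := T\<rparr> Mod N)"
    proof (rule Q.hall_dominant_if_abelian)
      show finQ: "finite (carrier (G\<lparr>carrier := T\<rparr> Mod N))"
        using finsub[OF subgroup.subset[OF T(1)]] by (simp add: carrier_FactGroup)
      fix x y assume "x \<in> Q" "y \<in> Q"
      then obtain a b where ab: "a \<in> D i" "b \<in> D i"
          "x = N #>\<^bsub>G\<lparr>carrier := T\<rparr>\<^esub> a" "y = N #>\<^bsub>G\<lparr>carrier := T\<rparr>\<^esub> b" by (auto simp: Q_def)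
      then have abT: "a \<in> T" "b \<in> T" "a \<in> carrier G" "b \<in> carrier G"
        using T(3) subgroup.mem_carrier[OF sD] by auto
      have "a \<otimes> b \<otimes> inv a \<otimes> inv b \<in> N"
        unfolding N_def DSuc derived_def using ab(1,2) by (intro generate.incl) auto
      moreover have "a \<otimes> b = (a \<otimes> b \<otimes> inv a \<otimes> inv b) \<otimes> (b \<otimes> a)"
        using abT by (simp add: m_assoc mult_inv_cancel)
      ultimately have "a \<otimes> b \<in> N #> (b \<otimes> a)" unfolding r_coset_def by blast
      then have "N #> (a \<otimes> b) = N #> (b \<otimes> a)"
        using repr_independence[of "a \<otimes> b" N "b \<otimes> a"] abT sN by simp
      then show "x \<otimes>\<^bsub>G\<lparr>carrier := T\<rparr> Mod N\<^esub> y = y \<otimes>\<^bsub>G\<lparr>carrier := T\<rparr> Mod N\<^esub> x"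
        using ab abT N.rcos_sum[of a b] N.rcos_sum[of b a] by simp
    next
      have "card Q * card N = card (D i)"
        using N.card_image_subgroup[OF N.r_coset_group_hom normal_imp_subgroup[OF DT]] ND
        unfolding N.kernel_r_coset Q_def by (simp add: Int_absorb1)
      moreover have "card (rcosets\<^bsub>G\<lparr>carrier := T\<rparr> Mod N\<^esub> Q) * card Q = order (G\<lparr>carrier := T\<rparr> Mod N)"
        by (rule q.H.lagrange[OF normal_imp_subgroup[OF Q]])
      moreover have "order (G\<lparr>carrier := T\<rparr> Mod N) * card N = card T"
        using N.lagrange[OF N.is_subgroup] by (simp add: FactGroup_def order_def)
      ultimately have "card (rcosets\<^bsub>G\<lparr>carrier := T\<rparr> Mod N\<^esub> Q) * card (D i) = card T"
        by (metis mult.assoc)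
      then have "card (rcosets\<^bsub>G\<lparr>carrier := T\<rparr> Mod N\<^esub> Q) = card T div card (D i)"
        using pos[OF sD] by (metis nonzero_mult_div_cancel_right less_not_refl)
      then show "pi_number \<pi> (card (rcosets\<^bsub>G\<lparr>carrier := T\<rparr> Mod N\<^esub> Q))" using T(4) by simp
    qed
    moreover have "pi_number \<pi> (card U div card (U \<inter> N))"
    proof -
      have "card (U \<inter> N) dvd card U" using U sN by (intro card_subgroup_dvd subgroups_Inter_pair) auto
      then show ?thesis using piU by (intro pi_number_div)
    qed
    ultimately obtain T' where T': "subgroup T' G" "U \<subseteq> T'" "N \<subseteq> T'" "T' \<subseteq> T"
      "pi_number \<pi> (card T' div card N)" "pi_number (- \<pi>) (card T div card T')"
      using hall_dominant_section[OF fin T(1) NT _ U T(2)] by blast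
    have "card T' dvd card T" "card T dvd order G"
      using card_subgroup_dvd[OF T'(1) T(1) T'(4)]
        card_subgroup_dvd[OF T(1) subgroup_self subgroup.subset[OF T(1)]] by (auto simp: order_def)
    then have "order G div card T' = (order G div card T) * (card T div card T')"
      using pos[OF T(1)] pos[OF T'(1)] by (auto elim!: dvdE)
    then have "pi_number (- \<pi>) (order G div card T')" using T(5) T'(6) by (simp add: pi_number_mult)
    then show ?case using T' by (auto simp: N_def)
  qed
  note tower = this
  obtain n where "D n = {\<one>}"
    using sol solvable_iff_trivial_derived_seq unfolding D_def by blast
  then have "card (D n) = 1" by simp
  then show "\<exists>T. subgroup T G \<and> U \<subseteq> T \<and> pi_number \<pi> (card T) \<and> pi_number (- \<pi>) (order G div card T)"
    using tower[of n] by auto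
qed

text \<open>The length of every orbit is a power of \<^term>\<open>p\<close>. If none had length 1, their lengths would add up to a
  multiple of \<^term>\<open>p\<close>.\<close>

lemma (in group_action) fixed_point_of_prime_power_group:
  assumes fin: "finite E" and p: "prime p" and ord: "order G = p ^ k" and np: "\<not> p dvd card E"
  shows "\<exists>x\<in>E. \<forall>g\<in>carrier G. \<phi> g x = x"
proof -
  have "card E = (\<Sum>orb\<in>orbits G E \<phi>. card orb)"
    using disjoint_sum[OF fin, of "\<lambda>_. 1 :: nat"] by simp
  then obtain Y where Y: "Y \<in> orbits G E \<phi>" "\<not> p dvd card Y" using np dvd_sum by metis
  then obtain x where x: "x \<in> E" "Y = orbit G \<phi> x" by (auto simp: orbits_def)
  have "card Y dvd p ^ k" using orbit_stabilizer_theorem[OF x(1)] x(2) ord by (metis dvd_triv_left)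
  then obtain i where i: "card Y = p ^ i" using p by (auto simp: divides_primepow_nat)
  then have "card Y = 1" using Y(2) by (cases i) auto
  then obtain y where "orbit G \<phi> x = {y}" using x(2) by (metis card_1_singletonE)
  moreover have "x \<in> orbit G \<phi> x" using x(1) by (rule orbit_refl)
  ultimately have "orbit G \<phi> x = {x}" by auto
  then show ?thesis using x(1) by (auto simp: orbit_def)
qed

text \<open>Let the \<open>p\<close>-subgroup \<open>U\<close> act by right multiplication on the right cosets of a Sylow subgroup \<open>P\<close>. Their
  number is prime to \<open>p\<close>, so \<open>U\<close> fixes some coset of \<open>P\<close>, say that of \<open>x\<close>, which means that \<open>U\<close> lies in the
  conjugate of \<open>P\<close> by \<open>x\<close>.\<close>

theorem (in group) hall_dominant_prime:
  assumes fin: "finite (carrier G)" and p: "prime p"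
  shows "hall_dominant {p} G"
  unfolding hall_dominant_def
proof (intro allI impI)
  fix U assume U: "subgroup U G" and piU: "pi_number {p} (card U)"
  interpret U: subgroup U G by fact
  have "order G > 0" using fin by (simp add: order_gt_0_iff_finite)
  then obtain a m where am: "order G = p ^ a * m" "pi_number (- {p}) m"
    using pi_part_exists[of "order G" "{p}"] pi_number_singleton_iff[OF p] by metis
  obtain P where P: "subgroup P G" "card P = p ^ a"
    using sylow_thm[OF p is_group am(1) fin] by blast
  interpret P: subgroup P G by fact
  have cQ: "card (rcosets P) = m"
    using lagrange[OF P(1)] am(1) P(2) p by (simp add: prime_gt_0_nat)
  \<comment> \<open>The inverse turns right multiplication into a left action.\<close>
  define \<phi> where "\<phi> u = (\<lambda>C \<in> rcosets P. C #> inv u)" for u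
  have cl: "C #> u \<in> rcosets P" if "u \<in> carrier G" "C \<in> rcosets P" for u C
    using that P.subset by (auto simp: RCOSETS_def coset_mult_assoc)
  have "group_action (G\<lparr>carrier := U\<rparr>) (rcosets P) \<phi>"
  proof -
    have sub: "C \<subseteq> carrier G" if "C \<in> rcosets P" for C using that P.rcosets_carrier is_group by blast
    have bij: "\<phi> u \<in> Bij (rcosets P)" if u: "u \<in> U" for u
    proof -
      have "bij_betw (\<phi> u) (rcosets P) (rcosets P)"
        by (rule bij_betw_byWitness[where f' = "\<phi> (inv u)"])
           (use u cl sub in \<open>auto simp: \<phi>_def coset_mult_assoc\<close>)
      then show ?thesis by (simp add: Bij_def \<phi>_def)
    qed
    have "\<phi> (u \<otimes> v) = compose (rcosets P) (\<phi> u) (\<phi> v)" if "u \<in> U" "v \<in> U" for u v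
      using that cl sub by (auto simp: \<phi>_def compose_def fun_eq_iff coset_mult_assoc inv_mult_group)
    then have "\<phi> \<in> hom (G\<lparr>carrier := U\<rparr>) (BijGroup (rcosets P))"
      using bij by (auto simp: hom_def BijGroup_def)
    then show ?thesis
      by (simp add: group_action_def group_hom_def group_hom_axioms_def group_BijGroup
          subgroup_imp_group[OF U])
  qed
  moreover have "finite (rcosets P)"
    using fin rcosets_subset_PowG[OF P(1)] by (meson finite_Pow_iff finite_subset)
  moreover obtain k where "order (G\<lparr>carrier := U\<rparr>) = p ^ k"
    using piU pi_number_singleton_iff[OF p] by (auto simp: order_def)
  moreover have "\<not> p dvd card (rcosets P)" using am(2) p by (auto simp: cQ pi_number_def)
  ultimately obtain C where C: "C \<in> rcosets P" "\<forall>u\<in>U. \<phi> u C = C"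
    using group_action.fixed_point_of_prime_power_group[of "G\<lparr>carrier := U\<rparr>" "rcosets P" \<phi> p k] p
    by auto
  then obtain x where x: "x \<in> carrier G" "C = P #> x" by (auto simp: RCOSETS_def)
  define T where "T = (\<lambda>y. inv x \<otimes> y \<otimes> x) ` P"
  interpret c: group_hom G G "\<lambda>y. inv x \<otimes> y \<otimes> x"
    using x(1) by unfold_locales (auto simp: hom_def m_assoc mult_inv_cancel)
  have T: "subgroup T G" unfolding T_def using P(1) by (rule c.subgroup_img_is_subgroup)
  have "inj_on (\<lambda>y. inv x \<otimes> y \<otimes> x) P"
    using x(1) by (auto simp: inj_on_def)
  then have cT: "card T = p ^ a" unfolding T_def by (simp add: card_image P(2))
  have "U \<subseteq> T"
  proof
    fix u assume u: "u \<in> U"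
    have "\<phi> (inv u) C = C" using C(2) U.m_inv_closed[OF u] by blast
    then have "P #> x #> u = P #> x" using C(1) u x(2) by (simp add: \<phi>_def)
    then have "x \<otimes> u \<in> P #> x"
      using rcos_self[OF _ P(1), of "x \<otimes> u"] x(1) u P.subset by (simp add: coset_mult_assoc)
    then have "x \<otimes> u \<otimes> inv x \<in> P" using x(1) by (intro P.rcos_module_imp is_group)
    moreover have "u = inv x \<otimes> (x \<otimes> u \<otimes> inv x) \<otimes> x"
      using x(1) u by (simp add: m_assoc mult_inv_cancel)
    ultimately show "u \<in> T" unfolding T_def by blast
  qed
  moreover have "pi_number {p} (card T)" using cT pi_number_singleton_iff[OF p] by blast
  moreover have "order G div card T = m" using am(1) cT p by (simp add: prime_gt_0_nat)
  ultimately show "\<exists>T. subgroup T G \<and> U \<subseteq> T \<and> pi_number {p} (card T) \<and>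
      pi_number (- {p}) (order G div card T)"
    using T am(2) by auto
qed

lemma (in group) solvable_section:
  assumes "solvable G" "subgroup W G" "N \<lhd> G\<lparr>carrier := W\<rparr>"
  shows "solvable (G\<lparr>carrier := W\<rparr> Mod N)"
proof -
  interpret N: normal N "G\<lparr>carrier := W\<rparr>" by fact
  interpret i: group_hom "G\<lparr>carrier := W\<rparr>" G "\<lambda>x. x"
    using subgroup.subset[OF assms(2)] by unfold_locales (auto simp: hom_def)
  have "solvable (G\<lparr>carrier := W\<rparr>)" using assms(1) by (intro i.inj_hom_imp_solvable) auto
  then show ?thesis
    by (rule group_hom.surj_hom_imp_solvable[OF N.r_coset_group_hom, rotated])
       (auto simp: carrier_FactGroup)
qed

lemma (in group) hall_dominant_factor:
  assumes fin: "finite (carrier G)" and W: "subgroup W G" and N: "N \<lhd> G\<lparr>carrier := W\<rparr>"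
    and sol: "solvable G \<or> (\<exists>p. prime p \<and> \<pi> = {p})"
  shows "hall_dominant \<pi> (G\<lparr>carrier := W\<rparr> Mod N)"
proof -
  interpret Q: group "G\<lparr>carrier := W\<rparr> Mod N" using N by (rule normal.factorgroup_is_group)
  have "finite (carrier (G\<lparr>carrier := W\<rparr> Mod N))"
    using finite_subset[OF subgroup.subset[OF W] fin] by (simp add: carrier_FactGroup)
  then show ?thesis
    using sol solvable_section[OF _ W N] Q.hall_dominant_if_solvable Q.hall_dominant_prime by blast
qed

lemma (in group) endo_generate:
  assumes "group_hom G G h" "X \<subseteq> carrier G" "h ` X \<subseteq> generate G X"
  shows "h ` generate G X \<subseteq> generate G X"
proof -
  have "h ` generate G X = generate G (h ` X)"
    using group_hom.generate_img[OF assms(1,2)] by simp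
  also have "\<dots> \<subseteq> generate G X"
    using assms(3) generate_is_subgroup[OF assms(2)] by (rule generate_subgroup_incl)
  finally show ?thesis .
qed

section \<open>The action of a skew brace on its additive group\<close>

definition semidirect ::
  "('a, 'b) monoid_scheme \<Rightarrow> ('a, 'c) monoid_scheme \<Rightarrow> ('a \<times> 'a) monoid"
  where "semidirect A M =
    \<lparr>carrier = carrier A \<times> carrier M,
     monoid.mult = (\<lambda>(a, x) (b, y). (a \<otimes>\<^bsub>A\<^esub> lambda_map A M x b, x \<otimes>\<^bsub>M\<^esub> y)),
     one = (\<one>\<^bsub>A\<^esub>, \<one>\<^bsub>M\<^esub>)\<rparr>"

lemma semidirect_simps [simp]:
  "carrier (semidirect A M) = carrier A \<times> carrier M"
  "(a, x) \<otimes>\<^bsub>semidirect A M\<^esub> (b, y) = (a \<otimes>\<^bsub>A\<^esub> lambda_map A M x b, x \<otimes>\<^bsub>M\<^esub> y)"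
  "\<one>\<^bsub>semidirect A M\<^esub> = (\<one>\<^bsub>A\<^esub>, \<one>\<^bsub>M\<^esub>)"
  by (simp_all add: semidirect_def)

context skew_brace
begin

lemma M_inv_closed [simp]: "a \<in> carrier A \<Longrightarrow> inv\<^bsub>M\<^esub> a \<in> carrier A"
  using M.inv_closed carrier_eq by simp

lemma lambda_map_inv:
  assumes "a \<in> carrier A" "b \<in> carrier A"
  shows "lambda_map A M (inv\<^bsub>M\<^esub> a) (lambda_map A M a b) = b"
    and "lambda_map A M a (lambda_map A M (inv\<^bsub>M\<^esub> a) b) = b"
  using assms carrier_eq by (simp_all add: lambda_map_mult[symmetric] lambda_map_one)

lemma lambda_map_group_hom:
  assumes "a \<in> carrier A"
  shows "group_hom A A (lambda_map A M a)"
  using assms by unfold_locales (auto simp: hom_def lambda_map_closed lambda_map_add)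

lemma lambda_map_zero: "a \<in> carrier A \<Longrightarrow> lambda_map A M a \<one>\<^bsub>A\<^esub> = \<one>\<^bsub>A\<^esub>"
  by (rule group_hom.hom_one[OF lambda_map_group_hom])

lemma lambda_map_neg:
  "a \<in> carrier A \<Longrightarrow> b \<in> carrier A \<Longrightarrow>
    lambda_map A M a (inv\<^bsub>A\<^esub> b) = inv\<^bsub>A\<^esub> (lambda_map A M a b)"
  by (rule group_hom.hom_inv[OF lambda_map_group_hom])

lemma group_semidirect: "group (semidirect A M)"
proof (rule groupI)
  fix g assume "g \<in> carrier (semidirect A M)"
  then obtain a x where g: "g = (a, x)" "a \<in> carrier A" "x \<in> carrier A" using carrier_eq by auto
  then have "(lambda_map A M (inv\<^bsub>M\<^esub> x) (inv\<^bsub>A\<^esub> a), inv\<^bsub>M\<^esub> x) \<otimes>\<^bsub>semidirect A M\<^esub> g = \<one>\<^bsub>semidirect A M\<^esub>"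
    using carrier_eq by (simp flip: lambda_map_add add: lambda_map_zero)
  then show "\<exists>h\<in>carrier (semidirect A M). h \<otimes>\<^bsub>semidirect A M\<^esub> g = \<one>\<^bsub>semidirect A M\<^esub>"
    using g carrier_eq lambda_map_closed
    by (intro bexI[of _ "(lambda_map A M (inv\<^bsub>M\<^esub> x) (inv\<^bsub>A\<^esub> a), inv\<^bsub>M\<^esub> x)"]) auto
qed (use carrier_eq in \<open>auto simp: lambda_map_closed lambda_map_mult lambda_map_add
      lambda_map_one A.m_assoc M.m_assoc M_closed\<close>)

lemma inv_semidirect:
  assumes "a \<in> carrier A" "x \<in> carrier A"
  shows "inv\<^bsub>semidirect A M\<^esub> (a, x) = (lambda_map A M (inv\<^bsub>M\<^esub> x) (inv\<^bsub>A\<^esub> a), inv\<^bsub>M\<^esub> x)"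
proof (rule group.inv_equality[OF group_semidirect])
  show "(lambda_map A M (inv\<^bsub>M\<^esub> x) (inv\<^bsub>A\<^esub> a), inv\<^bsub>M\<^esub> x) \<otimes>\<^bsub>semidirect A M\<^esub> (a, x) = \<one>\<^bsub>semidirect A M\<^esub>"
    using assms carrier_eq by (simp flip: lambda_map_add add: lambda_map_zero)
qed (use assms carrier_eq lambda_map_closed in auto)

lemma solvable_semidirect:
  assumes "solvable A" "solvable M"
  shows "solvable (semidirect A M)"
proof (rule solvable_condition[where G = A and K = M and f = "\<lambda>a. (a, \<one>\<^bsub>M\<^esub>)" and g = snd])
  show "group_hom A (semidirect A M) (\<lambda>a. (a, \<one>\<^bsub>M\<^esub>))"
    using group_semidirect
    by (auto simp: group_hom_def group_hom_axioms_def hom_def lambda_map_one)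
  show "group_hom (semidirect A M) M snd"
    using group_semidirect by (auto simp: group_hom_def group_hom_axioms_def hom_def)
  show "kernel (semidirect A M) M snd \<subseteq> (\<lambda>a. (a, \<one>\<^bsub>M\<^esub>)) ` carrier A"
    by (auto simp: kernel_def)
  show "snd ` carrier (semidirect A M) = carrier M" by (auto simp: image_def)
qed (use assms in auto)

lemma subgroup_semidirect:
  assumes P: "subgroup P A" and Q: "subgroup Q M"
    and inv: "\<And>q. q \<in> Q \<Longrightarrow> lambda_map A M q ` P \<subseteq> P"
  shows "subgroup (P \<times> Q) (semidirect A M)"
proof (rule group.subgroupI[OF group_semidirect])
  interpret P: subgroup P A by fact
  interpret Q: subgroup Q M by fact
  show "P \<times> Q \<subseteq> carrier (semidirect A M)" using P.subset Q.subset by auto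
  show "P \<times> Q \<noteq> {}" using P.one_closed Q.one_closed by blast
  fix g assume g: "g \<in> P \<times> Q"
  then obtain a x where ax: "g = (a, x)" "a \<in> P" "x \<in> Q" by auto
  then have "a \<in> carrier A" "x \<in> carrier A" using P.subset Q.subset carrier_eq by blast+
  then show "inv\<^bsub>semidirect A M\<^esub> g \<in> P \<times> Q"
    using ax inv[of "inv\<^bsub>M\<^esub> x"] by (auto simp: inv_semidirect)
  fix h assume h: "h \<in> P \<times> Q"
  then obtain b y where "h = (b, y)" "b \<in> P" "y \<in> Q" by auto
  then show "g \<otimes>\<^bsub>semidirect A M\<^esub> h \<in> P \<times> Q" using ax inv[of x] by auto
qed

text \<open>Closure under $\circ$ comes from $a \circ b = a + \lambda_a(b)$. The inverse of $a$ in $(B,\circ)$ is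
  $\lambda_{\bar a}(-a)$, where $\bar a$ is that inverse itself; it acts on \<open>P\<close> because it belongs to \<open>C\<close>.\<close>

lemma subgroup_M_if_invariant:
  assumes P: "subgroup P A" and C: "subgroup C M" and PC: "P \<subseteq> C"
    and inv: "\<And>c. c \<in> C \<Longrightarrow> lambda_map A M c ` P \<subseteq> P"
  shows "subgroup P M"
proof (rule M.subgroupI)
  interpret P: subgroup P A by fact
  interpret C: subgroup C M by fact
  show "P \<subseteq> carrier M" using P.subset carrier_eq by simp
  show "P \<noteq> {}" using P.one_closed by blast
  fix a assume a: "a \<in> P"
  have aA: "a \<in> carrier A" "a \<in> carrier M" using a carrier_eq by auto
  define b where "b = lambda_map A M (inv\<^bsub>M\<^esub> a) (inv\<^bsub>A\<^esub> a)"
  have b: "b \<in> P" using inv[of "inv\<^bsub>M\<^esub> a"] a PC by (auto simp: b_def)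
  have "a \<otimes>\<^bsub>M\<^esub> b = \<one>\<^bsub>M\<^esub>"
    using aA b by (simp add: M_eq b_def lambda_map_inv one_eq)
  moreover have "b \<in> carrier M" using b P.subset carrier_eq by blast
  ultimately have "inv\<^bsub>M\<^esub> a = b" using aA by (intro M.inv_unique'[symmetric]) (auto intro: M.inv_comm)
  then show "inv\<^bsub>M\<^esub> a \<in> P" using b by simp
  fix c assume "c \<in> P"
  then show "a \<otimes>\<^bsub>M\<^esub> c \<in> P" using a inv[of a] PC by (auto simp: M_eq)
qed

lemma left_ideal_subgroup_M:
  assumes "left_ideal S A M"
  shows "subgroup S M"
proof (rule subgroup_M_if_invariant[OF _ M.subgroup_self])
  show S: "subgroup S A" using assms by (simp add: left_ideal_def)
  show "S \<subseteq> carrier M" using subgroup.subset[OF S] carrier_eq by simp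
qed (use assms carrier_eq in \<open>simp add: left_ideal_def\<close>)

text \<open>The inclusion $R \ast B \subseteq J$ says that \<open>R\<close> acts trivially on $(B,+)/J$. Then conjugating an
  element of $J \times R$ by $b \in B$ changes it only by elements of the normal subgroup \<open>J\<close>.\<close>

lemma normal_semidirect:
  assumes J: "J \<lhd> A" "left_ideal J A M" and R: "R \<lhd> M"
    and star: "\<And>r b. r \<in> R \<Longrightarrow> b \<in> carrier A \<Longrightarrow> brace_star A M r b \<in> J"
  shows "J \<times> R \<lhd> semidirect A M"
proof (rule group.normal_invI[OF group_semidirect])
  interpret J: normal J A by fact
  interpret R: normal R M by fact
  have inv: "lambda_map A M a j \<in> J" if "a \<in> carrier A" "j \<in> J" for a j
    using J(2) that by (auto simp: left_ideal_def)
  show "subgroup (J \<times> R) (semidirect A M)"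
    using J R.subset carrier_eq
    by (intro subgroup_semidirect J.is_subgroup R.is_subgroup) (auto simp: inv)
  fix g h assume "g \<in> carrier (semidirect A M)" "h \<in> J \<times> R"
  then obtain b y j r where g: "g = (b, y)" "b \<in> carrier A" "y \<in> carrier A"
    and h: "h = (j, r)" "j \<in> J" "r \<in> R" using carrier_eq by auto
  have rA: "r \<in> carrier A" using h(3) R.subset carrier_eq by blast
  define s where "s = y \<otimes>\<^bsub>M\<^esub> r \<otimes>\<^bsub>M\<^esub> inv\<^bsub>M\<^esub> y"
  have sR: "s \<in> R" unfolding s_def using g(3) h(3) carrier_eq by (intro R.inv_op_closed2) auto
  then have s: "s \<in> R" "s \<in> carrier A" using R.subset carrier_eq by blast+
  define t where "t = brace_star A M s (inv\<^bsub>A\<^esub> b)"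
  have t: "t \<in> J" unfolding t_def using s g by (intro star) auto
  have "lambda_map A M s (inv\<^bsub>A\<^esub> b) = t \<otimes>\<^bsub>A\<^esub> inv\<^bsub>A\<^esub> b"
    unfolding t_def brace_star_def using s g by (simp add: A.m_assoc lambda_map_closed)
  moreover have "lambda_map A M (y \<otimes>\<^bsub>M\<^esub> r) (lambda_map A M (inv\<^bsub>M\<^esub> y) (inv\<^bsub>A\<^esub> b)) = lambda_map A M s (inv\<^bsub>A\<^esub> b)"
    unfolding s_def using g rA by (simp add: lambda_map_mult M_closed lambda_map_closed)
  ultimately have "g \<otimes>\<^bsub>semidirect A M\<^esub> h \<otimes>\<^bsub>semidirect A M\<^esub> inv\<^bsub>semidirect A M\<^esub> g
      = (b \<otimes>\<^bsub>A\<^esub> (lambda_map A M y j \<otimes>\<^bsub>A\<^esub> t) \<otimes>\<^bsub>A\<^esub> inv\<^bsub>A\<^esub> b, s)"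
    using g h t by (simp add: inv_semidirect s_def A.m_assoc lambda_map_closed)
  then show "g \<otimes>\<^bsub>semidirect A M\<^esub> h \<otimes>\<^bsub>semidirect A M\<^esub> inv\<^bsub>semidirect A M\<^esub> g \<in> J \<times> R"
    using J.inv_op_closed2[OF g(2)] inv g(3) h(2) t s(1) by simp
qed

text \<open>Inside the subgroup $C \rtimes C$ of the semidirect product, modulo its normal subgroup $J \rtimes R$,
  the image of $S \rtimes C$ is a $\pi$-group. Let \<open>T\<close> be the preimage of a Hall $\pi$-subgroup that contains
  it. As \<open>T\<close> contains $0 \rtimes C$, it splits as $D \rtimes C$ with a \<open>C\<close>-stable subgroup \<open>D\<close> of $(B,+)$, and
  comparing orders gives the index conditions for \<open>D\<close>.\<close>

theorem refine_sub_skew_brace: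
  assumes fin: "finite (carrier A)"
    and sol: "solvable A \<and> solvable M \<or> (\<exists>p. prime p \<and> \<pi> = {p})"
    and S: "left_ideal S A M" and piS: "pi_number \<pi> (card S)"
    and C: "sub_skew_brace C A M" "S \<subseteq> C"
    and J: "J \<lhd> A" "left_ideal J A M" "J \<subseteq> C"
    and R: "R \<lhd> M" "R \<subseteq> C" and piC: "pi_number \<pi> (card C div card R)"
    and star: "\<And>r b. r \<in> R \<Longrightarrow> b \<in> carrier A \<Longrightarrow> brace_star A M r b \<in> J"
  shows "\<exists>D. sub_skew_brace D A M \<and> S \<subseteq> D \<and> J \<subseteq> D \<and> pi_number \<pi> (card D div card J) \<and>
    pi_number (- \<pi>) (card C div card D) \<and> D \<subseteq> C"
proof -
  let ?G = "semidirect A M"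
  interpret G: group ?G by (rule group_semidirect)
  have CA: "subgroup C A" and CM: "subgroup C M" using C(1) by (auto simp: sub_skew_brace_def)
  interpret CA: subgroup C A by fact
  interpret CM: subgroup C M by fact
  have SA: "subgroup S A" and JA: "subgroup J A" and RM: "subgroup R M"
    using S J R normal_imp_subgroup by (auto simp: left_ideal_def)
  have finG: "finite (carrier ?G)" using fin carrier_eq by simp
  have pos: "card X > 0" if "subgroup X A \<or> subgroup X M" for X
    using that fin carrier_eq subgroup.finite_imp_card_positive by metis
  have CC: "lambda_map A M c b \<in> C" if "c \<in> C" "b \<in> C" for b c
    using that carrier_eq by (auto simp: lambda_map_def)
  have W: "subgroup (C \<times> C) ?G" using CA CM CC by (intro subgroup_semidirect) auto
  have U: "subgroup (S \<times> C) ?G"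
    using S CM by (intro subgroup_semidirect SA) (auto simp: left_ideal_def image_subset_iff)
  have N: "J \<times> R \<lhd> ?G\<lparr>carrier := C \<times> C\<rparr>"
    using normal_semidirect[OF J(1,2) R(1) star] W J(3) R(2) by (intro G.normal_restrict_supergroup) auto
  have "solvable ?G \<or> (\<exists>p. prime p \<and> \<pi> = {p})" using sol solvable_semidirect by blast
  then have dom: "hall_dominant \<pi> (?G\<lparr>carrier := C \<times> C\<rparr> Mod (J \<times> R))"
    by (rule G.hall_dominant_factor[OF finG W N])
  have "card (S \<times> C) div card ((S \<times> C) \<inter> (J \<times> R)) = (card S div card (S \<inter> J)) * (card C div card R)"
  proof -
    have "(S \<times> C) \<inter> (J \<times> R) = (S \<inter> J) \<times> R" using R(2) by auto
    then show ?thesis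
      using A.card_subgroup_dvd[OF A.subgroups_Inter_pair[OF SA JA] SA] M.card_subgroup_dvd[OF RM CM R(2)]
      by (simp add: card_cartesian_product div_mult_div_if_dvd[symmetric])
  qed
  moreover have "pi_number \<pi> (card S div card (S \<inter> J))"
    using A.card_subgroup_dvd[OF A.subgroups_Inter_pair[OF SA JA] SA] piS by (intro pi_number_div) auto
  ultimately have "pi_number \<pi> (card (S \<times> C) div card ((S \<times> C) \<inter> (J \<times> R)))"
    using piC by (simp add: pi_number_mult)
  then obtain T where T: "subgroup T ?G" "S \<times> C \<subseteq> T" "J \<times> R \<subseteq> T" "T \<subseteq> C \<times> C"
      "pi_number \<pi> (card T div card (J \<times> R))" "pi_number (- \<pi>) (card (C \<times> C) div card T)"
    using G.hall_dominant_section[OF finG W N dom U] C(2) by blast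
  interpret T: subgroup T ?G by fact
  define D where "D = {a. (a, \<one>\<^bsub>M\<^esub>) \<in> T}"
  have DC: "D \<subseteq> C" using T(4) by (auto simp: D_def)
  have one_c: "(\<one>\<^bsub>A\<^esub>, c) \<in> T" if "c \<in> C" for c
    using that T(2) subgroup.one_closed[OF SA] by blast
  \<comment> \<open>Conjugation by $(0, c)$ in the semidirect product is the action of $\lambda_c$.\<close>
  have conj: "lambda_map A M c a \<in> D" if c: "c \<in> C" and a: "a \<in> D" for c a
  proof -
    have "(\<one>\<^bsub>A\<^esub>, c) \<otimes>\<^bsub>?G\<^esub> (a, \<one>\<^bsub>M\<^esub>) \<otimes>\<^bsub>?G\<^esub> (\<one>\<^bsub>A\<^esub>, inv\<^bsub>M\<^esub> c) \<in> T"
      using one_c c a by (intro T.m_closed) (auto simp: D_def)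
    moreover have "c \<in> carrier A" "a \<in> carrier A" "c \<in> carrier M" using c a DC by auto
    ultimately show ?thesis by (simp add: D_def lambda_map_closed lambda_map_zero)
  qed
  have D: "subgroup D A"
  proof (rule A.subgroupI)
    show "D \<subseteq> carrier A" using DC by auto
    show "D \<noteq> {}" using one_c[OF CM.one_closed] by (auto simp: D_def)
    fix a assume a: "a \<in> D"
    then have aA: "a \<in> carrier A" "(a, \<one>\<^bsub>M\<^esub>) \<in> T" using DC by (auto simp: D_def)
    then show "inv\<^bsub>A\<^esub> a \<in> D"
      using T.m_inv_closed[of "(a, \<one>\<^bsub>M\<^esub>)"]
      by (simp add: D_def inv_semidirect one_eq) (simp add: lambda_map_one flip: one_eq)
    fix b assume b: "b \<in> D"
    then have "b \<in> carrier A" "(b, \<one>\<^bsub>M\<^esub>) \<in> T" using DC by (auto simp: D_def)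
    then show "a \<otimes>\<^bsub>A\<^esub> b \<in> D"
      using T.m_closed[of "(a, \<one>\<^bsub>M\<^esub>)" "(b, \<one>\<^bsub>M\<^esub>)"] aA by (simp add: D_def lambda_map_one)
  qed
  have TD: "T = D \<times> C"
  proof (intro subset_antisym subsetI)
    fix g assume g: "g \<in> T"
    then obtain a c where ac: "g = (a, c)" "a \<in> C" "c \<in> C" using T(4) by auto
    have "(a, c) \<otimes>\<^bsub>?G\<^esub> (\<one>\<^bsub>A\<^esub>, inv\<^bsub>M\<^esub> c) \<in> T"
      using g ac one_c by (intro T.m_closed) auto
    moreover have "a \<in> carrier A" "c \<in> carrier A" "c \<in> carrier M" using ac by auto
    ultimately show "g \<in> D \<times> C" using ac by (simp add: D_def lambda_map_zero)
  next
    fix g assume "g \<in> D \<times> C"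
    then obtain a c where ac: "g = (a, c)" "a \<in> D" "c \<in> C" by auto
    have "(a, \<one>\<^bsub>M\<^esub>) \<otimes>\<^bsub>?G\<^esub> (\<one>\<^bsub>A\<^esub>, c) \<in> T"
      using ac one_c by (intro T.m_closed) (auto simp: D_def)
    moreover have "a \<in> carrier A" "c \<in> carrier M" using ac DC by auto
    ultimately show "g \<in> T" using ac by (simp add: lambda_map_one)
  qed
  have SD: "S \<subseteq> D" using T(2) CM.one_closed by (auto simp: D_def)
  have JD: "J \<subseteq> D" using T(3) subgroup.one_closed[OF RM] by (auto simp: D_def)
  have DM: "subgroup D M" using conj by (intro subgroup_M_if_invariant[OF D CM DC]) auto
  have "card T div card (J \<times> R) = (card D div card J) * (card C div card R)"
    using A.card_subgroup_dvd[OF JA D JD] M.card_subgroup_dvd[OF RM CM R(2)]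
    by (simp add: TD card_cartesian_product div_mult_div_if_dvd[symmetric])
  then have "pi_number \<pi> (card D div card J)" using T(5) by (simp add: pi_number_mult)
  moreover have "card (C \<times> C) div card T = card C div card D"
    using pos[of C] CA by (simp add: TD card_cartesian_product)
  ultimately show ?thesis
    using T(6) D DM SD JD DC by (auto simp: sub_skew_brace_def)
qed

section \<open>Right nilpotent skew braces\<close>

lemma brace_star_closed:
  "a \<in> carrier A \<Longrightarrow> b \<in> carrier A \<Longrightarrow> brace_star A M a b \<in> carrier A"
  by (simp add: brace_star_def lambda_map_closed)

lemma lambda_map_eq_star:
  "a \<in> carrier A \<Longrightarrow> b \<in> carrier A \<Longrightarrow> lambda_map A M a b = brace_star A M a b \<otimes>\<^bsub>A\<^esub> b"
  by (simp add: brace_star_def lambda_map_closed A.m_assoc)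

definition brace_ideal :: "'a set \<Rightarrow> bool"
  where "brace_ideal I \<longleftrightarrow> left_ideal I A M \<and> I \<lhd> A \<and> I \<lhd> M"

text \<open>Normality in $(B,\circ)$ follows from $x \circ h = x + (x \ast h) + h$: this shows that
  $x \circ h$ lies in $h + I = h \circ I$.\<close>

lemma brace_idealI:
  assumes I: "left_ideal I A M" "I \<lhd> A"
    and star: "\<And>x b. x \<in> I \<Longrightarrow> b \<in> carrier A \<Longrightarrow> brace_star A M x b \<in> I"
  shows "brace_ideal I"
proof -
  interpret I: normal I A by fact
  have "I \<lhd> M"
  proof (rule M.normal_invI[OF left_ideal_subgroup_M[OF I(1)]])
    fix g x assume g: "g \<in> carrier M" and x: "x \<in> I"
    define h where "h = inv\<^bsub>M\<^esub> g"
    have h: "h \<in> carrier A" "g \<in> carrier A" "inv\<^bsub>M\<^esub> h = g" using g carrier_eq by (auto simp: h_def)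
    have xA: "x \<in> carrier A" using x by simp
    define z where "z = inv\<^bsub>A\<^esub> h \<otimes>\<^bsub>A\<^esub> (x \<otimes>\<^bsub>A\<^esub> brace_star A M x h) \<otimes>\<^bsub>A\<^esub> h"
    have z: "z \<in> I" unfolding z_def using x star h by (intro I.inv_op_closed1) auto
    define w where "w = lambda_map A M g z"
    have w: "w \<in> I" using I(1) z h by (auto simp: w_def left_ideal_def)
    have "x \<otimes>\<^bsub>M\<^esub> h = h \<otimes>\<^bsub>A\<^esub> z"
      using xA h by (simp add: M_eq lambda_map_eq_star z_def brace_star_closed A.m_assoc A.mult_inv_cancel)
    also have "\<dots> = h \<otimes>\<^bsub>M\<^esub> w"
      using h z w lambda_map_inv(1)[OF h(2), of z] unfolding w_def by (simp add: M_eq h_def)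
    finally have "x \<otimes>\<^bsub>M\<^esub> h = h \<otimes>\<^bsub>M\<^esub> w" .
    moreover have "x \<in> carrier M" "w \<in> carrier M" "h \<in> carrier M"
      using xA I.mem_carrier[OF w] h carrier_eq by auto
    ultimately have "g \<otimes>\<^bsub>M\<^esub> (x \<otimes>\<^bsub>M\<^esub> h) = w" "g \<otimes>\<^bsub>M\<^esub> (x \<otimes>\<^bsub>M\<^esub> h) = g \<otimes>\<^bsub>M\<^esub> x \<otimes>\<^bsub>M\<^esub> h"
      using g by (simp_all add: M.m_assoc h_def M.mult_inv_cancel)
    then have "g \<otimes>\<^bsub>M\<^esub> x \<otimes>\<^bsub>M\<^esub> inv\<^bsub>M\<^esub> g = w" by (simp add: h_def)
    then show "g \<otimes>\<^bsub>M\<^esub> x \<otimes>\<^bsub>M\<^esub> inv\<^bsub>M\<^esub> g \<in> I" using w by simp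
  qed
  then show ?thesis using I by (simp add: brace_ideal_def)
qed

text \<open>If $x \circ b = b \circ y$, then $x \ast b = -x + (b + \lambda_b(y) - b)$.\<close>

lemma star_mem_brace_ideal:
  assumes "brace_ideal I" "x \<in> I" "b \<in> carrier A"
  shows "brace_star A M x b \<in> I"
proof -
  have IA: "I \<lhd> A" and IM: "I \<lhd> M" using assms(1) by (auto simp: brace_ideal_def)
  interpret I: normal I A by fact
  have x: "x \<in> carrier A" "x \<in> carrier M" "b \<in> carrier M" using assms carrier_eq I.mem_carrier by auto
  define y where "y = inv\<^bsub>M\<^esub> b \<otimes>\<^bsub>M\<^esub> x \<otimes>\<^bsub>M\<^esub> b"
  have y: "y \<in> I" unfolding y_def using x assms by (intro normal.inv_op_closed1[OF IM])
  then have yA: "y \<in> carrier A" by simp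
  have ly: "lambda_map A M b y \<in> I" using assms y by (auto simp: brace_ideal_def left_ideal_def)
  have "x \<otimes>\<^bsub>A\<^esub> lambda_map A M x b = b \<otimes>\<^bsub>A\<^esub> lambda_map A M b y"
    using x assms(3) yA by (simp add: M_eq[symmetric] y_def M.m_assoc M.mult_inv_cancel)
  then have "lambda_map A M x b = inv\<^bsub>A\<^esub> x \<otimes>\<^bsub>A\<^esub> (b \<otimes>\<^bsub>A\<^esub> lambda_map A M b y)"
    using x assms(3) by (metis A.mult_inv_cancel(1) lambda_map_closed)
  then have "brace_star A M x b = inv\<^bsub>A\<^esub> x \<otimes>\<^bsub>A\<^esub> (b \<otimes>\<^bsub>A\<^esub> lambda_map A M b y \<otimes>\<^bsub>A\<^esub> inv\<^bsub>A\<^esub> b)"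
    using x assms(3) yA by (simp add: brace_star_def lambda_map_closed A.m_assoc)
  then show ?thesis using I.inv_op_closed2[OF assms(3) ly] assms(2) by simp
qed

lemma set_star_subset:
  assumes "subgroup J A" "\<And>x y. x \<in> X \<Longrightarrow> y \<in> Y \<Longrightarrow> brace_star A M x y \<in> J"
  shows "set_star A M X Y \<subseteq> J"
  unfolding set_star_def using assms by (intro A.generate_subgroup_incl) auto

lemma brace_star_mem_set_star: "x \<in> X \<Longrightarrow> y \<in> Y \<Longrightarrow> brace_star A M x y \<in> set_star A M X Y"
  unfolding set_star_def by (intro generate.incl) blast

text \<open>Conjugates of generators are controlled by
  $b + x \ast c - b = -(x \ast b) + x \ast (b + c)$, and their images under $\lambda$ by
  $\lambda_g(x \ast c) = (g \circ x \circ \bar g) \ast \lambda_g(c)$.\<close>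

lemma set_star_brace_ideal:
  assumes I: "brace_ideal I"
  shows "brace_ideal (set_star A M I (carrier A))"
proof (rule brace_idealI)
  have IA: "I \<lhd> A" and IM: "I \<lhd> M" using I by (auto simp: brace_ideal_def)
  interpret I: normal I A by fact
  define X where "X = {brace_star A M x y | x y. x \<in> I \<and> y \<in> carrier A}"
  have J: "set_star A M I (carrier A) = generate A X" by (simp add: set_star_def X_def)
  have X: "X \<subseteq> carrier A" using brace_star_closed by (auto simp: X_def)
  have sJ: "subgroup (generate A X) A" using X by (rule A.generate_is_subgroup)
  show "set_star A M I (carrier A) \<lhd> A"
    unfolding J
  proof (rule A.normal_invI[OF sJ])
    fix b h assume b: "b \<in> carrier A" and h: "h \<in> generate A X"
    have hom: "group_hom A A (\<lambda>h. b \<otimes>\<^bsub>A\<^esub> h \<otimes>\<^bsub>A\<^esub> inv\<^bsub>A\<^esub> b)"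
      using b by unfold_locales (auto simp: hom_def A.m_assoc A.mult_inv_cancel)
    have "b \<otimes>\<^bsub>A\<^esub> brace_star A M x c \<otimes>\<^bsub>A\<^esub> inv\<^bsub>A\<^esub> b \<in> generate A X"
      if x: "x \<in> I" and c: "c \<in> carrier A" for x c
    proof -
      have "b \<otimes>\<^bsub>A\<^esub> brace_star A M x c \<otimes>\<^bsub>A\<^esub> inv\<^bsub>A\<^esub> b
          = inv\<^bsub>A\<^esub> (brace_star A M x b) \<otimes>\<^bsub>A\<^esub> brace_star A M x (b \<otimes>\<^bsub>A\<^esub> c)"
        using x b c by (simp add: brace_star_def lambda_map_add lambda_map_closed
            A.inv_mult_group A.m_assoc A.mult_inv_cancel)
      moreover have "brace_star A M x b \<in> generate A X" "brace_star A M x (b \<otimes>\<^bsub>A\<^esub> c) \<in> generate A X"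
        using x b c by (auto simp: X_def intro!: generate.incl)
      ultimately show ?thesis using sJ by (simp add: subgroup.m_closed subgroup.m_inv_closed)
    qed
    then have "(\<lambda>h. b \<otimes>\<^bsub>A\<^esub> h \<otimes>\<^bsub>A\<^esub> inv\<^bsub>A\<^esub> b) ` X \<subseteq> generate A X" by (auto simp: X_def)
    then show "b \<otimes>\<^bsub>A\<^esub> h \<otimes>\<^bsub>A\<^esub> inv\<^bsub>A\<^esub> b \<in> generate A X"
      using A.endo_generate[OF hom X] h by blast
  qed
  have "lambda_map A M g ` generate A X \<subseteq> generate A X" if g: "g \<in> carrier A" for g
  proof (rule A.endo_generate[OF lambda_map_group_hom[OF g] X])
    have "lambda_map A M g (brace_star A M x c) \<in> X" if x: "x \<in> I" and c: "c \<in> carrier A" for x c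
    proof -
      define y where "y = g \<otimes>\<^bsub>M\<^esub> x \<otimes>\<^bsub>M\<^esub> inv\<^bsub>M\<^esub> g"
      have y: "y \<in> I" unfolding y_def using x g carrier_eq by (intro normal.inv_op_closed2[OF IM]) auto
      have "lambda_map A M y (lambda_map A M g c) = lambda_map A M g (lambda_map A M x c)"
        unfolding y_def using g x c by (simp add: lambda_map_mult M_closed lambda_map_closed lambda_map_inv)
      then have "lambda_map A M g (brace_star A M x c) = brace_star A M y (lambda_map A M g c)"
        using g x c by (simp add: brace_star_def lambda_map_add lambda_map_neg lambda_map_closed)
      then show ?thesis using y g c lambda_map_closed unfolding X_def by blast
    qed
    then show "lambda_map A M g ` X \<subseteq> generate A X" by (auto simp: X_def intro!: generate.incl)
  qed
  then show "left_ideal (set_star A M I (carrier A)) A M"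
    using sJ by (simp add: left_ideal_def J)
  have "set_star A M I (carrier A) \<subseteq> I"
    using star_mem_brace_ideal[OF I] by (intro set_star_subset I.is_subgroup)
  then show "brace_star A M x b \<in> set_star A M I (carrier A)"
    if "x \<in> set_star A M I (carrier A)" "b \<in> carrier A" for x b
    using that by (intro brace_star_mem_set_star) auto
qed

lemma right_series_brace_ideal: "brace_ideal (right_series A M k)"
proof (induction k)
  case 0
  show ?case
    using A.normal_self M.normal_self carrier_eq A.subgroup_self lambda_map_closed
    by (auto simp: brace_ideal_def left_ideal_def)
next
  case (Suc k)
  then show ?case by (simp add: set_star_brace_ideal)
qed

text \<open>The step from \<open>k\<close> to \<open>Suc k\<close> applies \<open>refine_sub_skew_brace\<close> to consecutive terms of the series: a
  term acts trivially modulo the next one by definition. The last term being trivial, the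
  sub-skew brace reached there has $\pi$-order.\<close>

theorem hall_containing_if_right_nilpotent:
  assumes fin: "finite (carrier A)"
    and sol: "solvable A \<and> solvable M \<or> (\<exists>p. prime p \<and> \<pi> = {p})"
    and nil: "right_nilpotent A M"
    and S: "left_ideal S A M" and piS: "pi_number \<pi> (card S)"
  shows "\<exists>H. sub_skew_brace H A M \<and> S \<subseteq> H \<and> pi_number \<pi> (card H) \<and>
    pi_number (- \<pi>) (order A div card H)"
proof -
  let ?R = "right_series A M"
  have R: "?R k \<lhd> A" "?R k \<lhd> M" "left_ideal (?R k) A M" for k
    using right_series_brace_ideal by (auto simp: brace_ideal_def)
  have pos: "card X > 0" if "subgroup X A" for X
    by (rule subgroup.finite_imp_card_positive[OF that fin])
  have tower: "\<exists>C. sub_skew_brace C A M \<and> S \<subseteq> C \<and> ?R k \<subseteq> C \<and>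
      pi_number \<pi> (card C div card (?R k)) \<and> pi_number (- \<pi>) (order A div card C)" for k
  proof (induction k)
    case 0
    have "subgroup (carrier A) M" using M.subgroup_self carrier_eq by simp
    moreover have "S \<subseteq> carrier A" using S subgroup.subset by (auto simp: left_ideal_def)
    ultimately show ?case
      using A.subgroup_self pos[OF A.subgroup_self]
      by (intro exI[of _ "carrier A"]) (auto simp: sub_skew_brace_def order_def pi_number_def)
  next
    case (Suc k)
    then obtain C where C: "sub_skew_brace C A M" "S \<subseteq> C" "?R k \<subseteq> C"
      "pi_number \<pi> (card C div card (?R k))" "pi_number (- \<pi>) (order A div card C)" by blast
    have RR: "?R (Suc k) \<subseteq> ?R k"
      using star_mem_brace_ideal[OF right_series_brace_ideal] normal_imp_subgroup[OF R(1)]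
      by (simp add: set_star_subset)
    have star: "brace_star A M r b \<in> ?R (Suc k)" if "r \<in> ?R k" "b \<in> carrier A" for r b
      using that by (simp add: brace_star_mem_set_star)
    obtain D where D: "sub_skew_brace D A M" "S \<subseteq> D" "?R (Suc k) \<subseteq> D"
      "pi_number \<pi> (card D div card (?R (Suc k)))" "pi_number (- \<pi>) (card C div card D)" "D \<subseteq> C"
      using refine_sub_skew_brace[OF fin sol S piS C(1,2) R(1,3) _ R(2) C(3,4) star] RR C(3) by blast
    have CD: "subgroup C A" "subgroup D A" using C D by (auto simp: sub_skew_brace_def)
    have "card D dvd card C" "card C dvd order A"
      using A.card_subgroup_dvd[OF CD(2,1) D(6)]
        A.card_subgroup_dvd[OF CD(1) A.subgroup_self subgroup.subset[OF CD(1)]] by (auto simp: order_def)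
    then have "order A div card D = (order A div card C) * (card C div card D)"
      using pos[OF CD(1)] pos[OF CD(2)] by (auto elim!: dvdE)
    then have "pi_number (- \<pi>) (order A div card D)" using C(5) D(5) by (simp add: pi_number_mult)
    then show ?case using D by blast
  qed
  obtain n where "?R n = {\<one>\<^bsub>A\<^esub>}" using nil by (auto simp: right_nilpotent_def)
  then have "card (?R n) = 1" by simp
  then show ?thesis using tower[of n] by auto
qed

text \<open>Computing $\lambda$ of $x \circ c = x + \lambda_x(c)$ in both groups gives
  $\lambda_{\lambda_x(c)} = \lambda_c$. Hence $x \ast c = \lambda_x(c) - c$ lies in the kernel of $\lambda$, and
  elements of the kernel have trivial $\ast$-products with $B$.\<close>

lemma right_nilpotent_if_lambda_homomorphic:
  assumes "lambda_homomorphic A M"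
  shows "right_nilpotent A M"
proof -
  have add: "lambda_map A M (a \<otimes>\<^bsub>A\<^esub> b) c = lambda_map A M a (lambda_map A M b c)"
    if "a \<in> carrier A" "b \<in> carrier A" "c \<in> carrier A" for a b c
  proof -
    have "lambda_map A M (a \<otimes>\<^bsub>A\<^esub> b) = lambda_map A M a \<otimes>\<^bsub>AutoGroup A\<^esub> lambda_map A M b"
      using assms that by (simp add: lambda_homomorphic_def hom_def)
    then show ?thesis
      using that lambda_map_auto by (simp add: AutoGroup_def BijGroup_def auto_def compose_eq)
  qed
  have zero: "lambda_map A M \<one>\<^bsub>A\<^esub> c = c" if "c \<in> carrier A" for c
    using lambda_map_one[OF that] by (simp add: one_eq)
  have inj: "b = c" if "a \<in> carrier A" "b \<in> carrier A" "c \<in> carrier A"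
      "lambda_map A M a b = lambda_map A M a c" for a b c
    using that lambda_map_inv(1) by metis
  define K where "K = {a \<in> carrier A. \<forall>c\<in>carrier A. lambda_map A M a c = c}"
  have K: "subgroup K A"
  proof (rule A.subgroupI)
    show "K \<noteq> {}" using zero by (auto simp: K_def)
    fix a assume a: "a \<in> K"
    then have aA: "a \<in> carrier A" by (simp add: K_def)
    have "lambda_map A M (inv\<^bsub>A\<^esub> a) c = c" if "c \<in> carrier A" for c
      using add[of "inv\<^bsub>A\<^esub> a" a c] a aA that zero by (simp add: K_def)
    then show "inv\<^bsub>A\<^esub> a \<in> K" using aA by (simp add: K_def)
    fix b assume "b \<in> K"
    then show "a \<otimes>\<^bsub>A\<^esub> b \<in> K" using a by (simp add: K_def add)
  qed (auto simp: K_def)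
  have "brace_star A M x c \<in> K" if x: "x \<in> carrier A" and c: "c \<in> carrier A" for x c
  proof -
    have "lambda_map A M (brace_star A M x c) y = y" if y: "y \<in> carrier A" for y
    proof -
      have 1: "lambda_map A M (lambda_map A M x c) z = lambda_map A M c z" if z: "z \<in> carrier A" for z
      proof (rule inj[OF x])
        show "lambda_map A M x (lambda_map A M (lambda_map A M x c) z) = lambda_map A M x (lambda_map A M c z)"
          using x c z by (simp add: add[symmetric] M_eq[symmetric] lambda_map_mult lambda_map_closed)
      qed (use x c z lambda_map_closed in auto)
      have "lambda_map A M (brace_star A M x c) y = lambda_map A M c (lambda_map A M (inv\<^bsub>A\<^esub> c) y)"
        unfolding brace_star_def using x c y by (simp add: add 1 lambda_map_closed)
      then show ?thesis using c y by (simp add: zero flip: add)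
    qed
    then show ?thesis using brace_star_closed[OF x c] by (simp add: K_def)
  qed
  then have RK: "right_series A M 1 \<subseteq> K" using K by (simp add: set_star_subset)
  have triv: "brace_star A M x c \<in> {\<one>\<^bsub>A\<^esub>}" if "x \<in> K" "c \<in> carrier A" for x c
    using that by (simp add: brace_star_def K_def)
  have "right_series A M (Suc 1) \<subseteq> {\<one>\<^bsub>A\<^esub>}"
    unfolding right_series.simps(2)[of A M 1] using RK triv
    by (intro set_star_subset[OF A.triv_subgroup]) blast
  moreover have "\<one>\<^bsub>A\<^esub> \<in> right_series A M (Suc 1)"
    using right_series_brace_ideal subgroup.one_closed by (metis brace_ideal_def left_ideal_def)
  ultimately show ?thesis unfolding right_nilpotent_def by blast
qed

section \<open>Bi-skew braces\<close>

text \<open>The $\lambda$-map $\lambda'$ of $(B,\circ,+)$ satisfies $\lambda'_a = \lambda_a^{-1}$, because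
  $a + b = a \circ \lambda_a^{-1}(b)$. As $\lambda'$ is a homomorphism on $(B,+)$, the map $\lambda$ is an
  antihomomorphism there.\<close>

lemma lambda_map_antihom_if_bi_skew:
  assumes "skew_brace M A" and a: "a \<in> carrier A" and b: "b \<in> carrier A" and c: "c \<in> carrier A"
  shows "lambda_map A M (a \<otimes>\<^bsub>A\<^esub> b) c = lambda_map A M (b \<otimes>\<^bsub>M\<^esub> a) c"
proof -
  interpret B: skew_brace M A by fact
  have inv: "lambda_map M A x (lambda_map A M x y) = y" if "x \<in> carrier A" "y \<in> carrier A" for x y
    using that carrier_eq lambda_map_closed[OF that]
    by (simp add: lambda_map_def[of M A] M_eq[symmetric] M.mult_inv_cancel)
  have inj: "x = y" if "z \<in> carrier A" "x \<in> carrier A" "y \<in> carrier A"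
      "lambda_map M A z x = lambda_map M A z y" for x y z
    using that B.lambda_map_inv(1)[of z] carrier_eq by metis
  show ?thesis
  proof (rule inj[of "a \<otimes>\<^bsub>A\<^esub> b"])
    have "lambda_map M A (a \<otimes>\<^bsub>A\<^esub> b) (lambda_map A M (b \<otimes>\<^bsub>M\<^esub> a) c)
        = lambda_map M A a (lambda_map M A b (lambda_map A M b (lambda_map A M a c)))"
      using a b c carrier_eq by (simp add: B.lambda_map_mult lambda_map_mult lambda_map_closed)
    then show "lambda_map M A (a \<otimes>\<^bsub>A\<^esub> b) (lambda_map A M (a \<otimes>\<^bsub>A\<^esub> b) c)
        = lambda_map M A (a \<otimes>\<^bsub>A\<^esub> b) (lambda_map A M (b \<otimes>\<^bsub>M\<^esub> a) c)"
      using a b c by (simp add: inv lambda_map_closed)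
  qed (use a b c lambda_map_closed M_closed in auto)
qed

text \<open>Modulo the kernel \<open>K\<close> of $\lambda$ the sum $a + b$ agrees with $b \circ a$, and $-a$ with the inverse of $a$
  in $(B,\circ)$. So a subgroup of $(B,\circ)$ containing \<open>K\<close> is a sub-skew brace.\<close>

theorem hall_containing_if_bi_skew:
  assumes fin: "finite (carrier A)"
    and sol: "solvable A \<and> solvable M \<or> (\<exists>p. prime p \<and> \<pi> = {p})"
    and bi: "bi_skew_brace A M"
    and S: "left_ideal S A M" and piS: "pi_number \<pi> (card S)"
  shows "\<exists>H. sub_skew_brace H A M \<and> S \<subseteq> H \<and> pi_number \<pi> (card H) \<and>
    pi_number (- \<pi>) (order A div card H)"
proof -
  have anti: "lambda_map A M (a \<otimes>\<^bsub>A\<^esub> b) c = lambda_map A M (b \<otimes>\<^bsub>M\<^esub> a) c"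
    if "a \<in> carrier A" "b \<in> carrier A" "c \<in> carrier A" for a b c
    using lambda_map_antihom_if_bi_skew that bi by (simp add: bi_skew_brace_def)
  have finM: "finite (carrier M)" using fin carrier_eq by simp
  have SM: "subgroup S M" using S by (rule left_ideal_subgroup_M)
  define K where "K = {a \<in> carrier A. \<forall>c\<in>carrier A. lambda_map A M a c = c}"
  have Kmem: "inv\<^bsub>M\<^esub> x \<otimes>\<^bsub>M\<^esub> y \<in> K"
    if "x \<in> carrier A" "y \<in> carrier A" "\<And>c. c \<in> carrier A \<Longrightarrow> lambda_map A M x c = lambda_map A M y c" for x y
    using that(1,2) by (simp add: K_def M_closed lambda_map_mult lambda_map_inv flip: that(3))
  have K: "K \<lhd> M"
  proof (rule M.normal_invI)
    show sub: "subgroup K M"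
    proof (rule M.subgroupI)
      show "K \<subseteq> carrier M" using carrier_eq by (auto simp: K_def)
      show "K \<noteq> {}" using lambda_map_one carrier_eq M.one_closed by (auto simp: K_def)
      fix a assume a: "a \<in> K"
      then show "inv\<^bsub>M\<^esub> a \<in> K" using lambda_map_inv(1)[of a] by (force simp: K_def)
      fix b assume "b \<in> K"
      then show "a \<otimes>\<^bsub>M\<^esub> b \<in> K" using a by (simp add: K_def M_closed lambda_map_mult)
    qed
    fix x h assume x: "x \<in> carrier M" and "h \<in> K"
    then show "x \<otimes>\<^bsub>M\<^esub> h \<otimes>\<^bsub>M\<^esub> inv\<^bsub>M\<^esub> x \<in> K"
      using carrier_eq
      by (simp add: K_def M_closed lambda_map_mult lambda_map_inv lambda_map_closed)
  qed
  interpret K: normal K M by fact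
  have Kr: "K \<lhd> M\<lparr>carrier := carrier M\<rparr>" using K by simp
  have "pi_number \<pi> (card S div card (S \<inter> K))"
    using M.card_subgroup_dvd[OF M.subgroups_Inter_pair[OF SM K.is_subgroup] SM] piS
    by (intro pi_number_div) auto
  moreover have "hall_dominant \<pi> (M\<lparr>carrier := carrier M\<rparr> Mod K)"
    using sol by (intro M.hall_dominant_factor[OF finM M.subgroup_self Kr]) blast
  ultimately obtain C where C: "subgroup C M" "S \<subseteq> C" "K \<subseteq> C"
      "pi_number \<pi> (card C div card K)" "pi_number (- \<pi>) (order M div card C)"
    using M.hall_dominant_section[OF finM M.subgroup_self Kr _ SM subgroup.subset[OF SM]]
    unfolding order_def by blast
  interpret C: subgroup C M by fact
  have CA: "C \<subseteq> carrier A" using C.subset carrier_eq by simp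
  have absorb: "x \<in> C" if "x \<in> carrier A" "y \<in> C"
    "\<And>c. c \<in> carrier A \<Longrightarrow> lambda_map A M x c = lambda_map A M y c" for x y
  proof -
    have "inv\<^bsub>M\<^esub> y \<otimes>\<^bsub>M\<^esub> x \<in> C" using Kmem[of y x] that CA C(3) by auto
    then have "y \<otimes>\<^bsub>M\<^esub> (inv\<^bsub>M\<^esub> y \<otimes>\<^bsub>M\<^esub> x) \<in> C" using that(2) by (rule C.m_closed[rotated])
    then show ?thesis using that CA carrier_eq by (auto simp: M.mult_inv_cancel)
  qed
  have "subgroup C A"
  proof (rule A.subgroupI[OF CA])
    show "C \<noteq> {}" using C.one_closed by blast
    fix a assume a: "a \<in> C"
    then have aA: "a \<in> carrier A" using CA by blast
    show "inv\<^bsub>A\<^esub> a \<in> C"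
    proof (rule absorb[of "inv\<^bsub>A\<^esub> a" "inv\<^bsub>M\<^esub> a"])
      show "inv\<^bsub>A\<^esub> a \<in> carrier A" using aA by simp
      show "inv\<^bsub>M\<^esub> a \<in> C" using a by simp
      fix c assume c: "c \<in> carrier A"
      have "lambda_map A M (inv\<^bsub>A\<^esub> a) (lambda_map A M a d) = d" if "d \<in> carrier A" for d
        using anti[of a "inv\<^bsub>A\<^esub> a" d] aA that lambda_map_one[OF that]
        by (simp add: lambda_map_mult one_eq)
      from this[of "lambda_map A M (inv\<^bsub>M\<^esub> a) c"]
      show "lambda_map A M (inv\<^bsub>A\<^esub> a) c = lambda_map A M (inv\<^bsub>M\<^esub> a) c"
        using aA c by (simp add: lambda_map_inv lambda_map_closed)
    qed
    fix b assume b: "b \<in> C"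
    then have bA: "b \<in> carrier A" using CA by blast
    show "a \<otimes>\<^bsub>A\<^esub> b \<in> C"
      by (rule absorb[OF A.m_closed[OF aA bA] C.m_closed[OF b a] anti[OF aA bA]])
  qed
  then have C': "sub_skew_brace C A M" using C(1) by (simp add: sub_skew_brace_def)
  have triv: "left_ideal {\<one>\<^bsub>A\<^esub>} A M"
    using A.triv_subgroup lambda_map_zero by (auto simp: left_ideal_def)
  have one: "{\<one>\<^bsub>A\<^esub>} \<subseteq> C" using C.one_closed one_eq by simp
  have star: "brace_star A M r b \<in> {\<one>\<^bsub>A\<^esub>}" if "r \<in> K" "b \<in> carrier A" for r b
    using that by (simp add: brace_star_def K_def)
  obtain D where D: "sub_skew_brace D A M" "S \<subseteq> D" "pi_number \<pi> (card D)"
      "pi_number (- \<pi>) (card C div card D)" "D \<subseteq> C"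
    using refine_sub_skew_brace[OF fin sol S piS C' C(2) A.one_is_normal triv one K C(3,4) star]
    by auto
  have DM: "subgroup D M" using D(1) by (simp add: sub_skew_brace_def)
  have "card D dvd card C" "card C dvd order M"
    using M.card_subgroup_dvd[OF DM C(1) D(5)]
      M.card_subgroup_dvd[OF C(1) M.subgroup_self C.subset] by (auto simp: order_def)
  moreover have "card C > 0" "card D > 0"
    using finM C(1) DM subgroup.finite_imp_card_positive by blast+
  ultimately have "order A div card D = (order M div card C) * (card C div card D)"
    using carrier_eq by (auto simp: order_def elim!: dvdE)
  then have "pi_number (- \<pi>) (order A div card D)" using C(5) D(4) by (simp add: pi_number_mult)
  then show ?thesis using D by blast
qed

theorem hall_containing_left_ideal:
  assumes "finite (carrier A)"
    and "bi_skew_brace A M \<or> right_nilpotent A M \<or> lambda_homomorphic A M"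
    and "solvable A \<and> solvable M \<or> (\<exists>p. prime p \<and> \<pi> = {p})"
    and "left_ideal S A M" and "pi_number \<pi> (card S)"
  shows "\<exists>H. sub_skew_brace H A M \<and> S \<subseteq> H \<and> card H = Max {m. m dvd order A \<and> pi_number \<pi> m}"
proof -
  obtain H where H: "sub_skew_brace H A M" "S \<subseteq> H" "pi_number \<pi> (card H)"
    "pi_number (- \<pi>) (order A div card H)"
    using hall_containing_if_bi_skew hall_containing_if_right_nilpotent
      right_nilpotent_if_lambda_homomorphic assms by metis
  have "subgroup H A" using H(1) by (simp add: sub_skew_brace_def)
  then have "card H dvd order A"
    using A.card_subgroup_dvd[OF _ A.subgroup_self] subgroup.subset by (metis order_def)
  then have "Max {m. m dvd order A \<and> pi_number \<pi> m} = card H" using H(3,4) by (rule Max_pi_divisor)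
  then show ?thesis using H(1,2) by auto
qed

end

theorem corollary8:
  fixes A :: "('a, 'b) monoid_scheme" and M :: "('a, 'c) monoid_scheme"
  assumes "skew_brace A M"
    and "finite (carrier A)"
    and "bi_skew_brace A M \<or> right_nilpotent A M \<or> lambda_homomorphic A M"
  shows "(\<forall>(p::nat) S. prime p \<longrightarrow> left_ideal S A M \<longrightarrow> (\<exists>k. card S = p ^ k) \<longrightarrow>
            (\<exists>H. sylow_sub_skew_brace p H A M \<and> S \<subseteq> H)) \<and>
         (solvable A \<longrightarrow> solvable M \<longrightarrow>
           (\<forall>(\<pi>::nat set) S. (\<forall>q\<in>\<pi>. prime q) \<longrightarrow> left_ideal S A M \<longrightarrow> pi_number \<pi> (card S) \<longrightarrow>
             (\<exists>H. hall_sub_skew_brace \<pi> H A M \<and> S \<subseteq> H)))"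
proof -
  interpret skew_brace A M by fact
  note hall = hall_containing_left_ideal[OF assms(2,3)]
  show ?thesis
  proof (intro conjI allI impI)
    fix p :: nat and S
    assume p: "prime p" and S: "left_ideal S A M" "\<exists>k. card S = p ^ k"
    then have "pi_number {p} (card S)" by (simp add: pi_number_singleton_iff)
    then show "\<exists>H. sylow_sub_skew_brace p H A M \<and> S \<subseteq> H"
      using hall[of "{p}" S] p S(1)
      by (auto simp: sylow_sub_skew_brace_def pi_number_singleton_iff)
  next
    fix \<pi> :: "nat set" and S
    assume "solvable A" "solvable M" "left_ideal S A M" "pi_number \<pi> (card S)"
    then show "\<exists>H. hall_sub_skew_brace \<pi> H A M \<and> S \<subseteq> H"
      using hall[of \<pi> S] by (auto simp: hall_sub_skew_brace_def)
  qed
qed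

end
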